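(* Let $p\in(1,2)$ be fixed and let $E_p(\beta):=\lim_{n\to\infty}\frac1n\log\mathcal{Z}_{n,p}(\beta)$ for $\beta\ge0$. Then for every $y\ge 0$, \[ \sup_{z\ge 0 }\left(\psi_{p}\big(\sqrt{y}\,z/(1+|z|^p)^{1/p}\big)-\frac1p\log(1+|z|^p)\right) =\sup_{x\ge 0}\left\{E_p(x y )-\frac{2-p}{2p}x^{\frac{p}{2-p}}\right\}. \] In particular, for $\beta\ge0$, \[ \lim_{n\to\infty}\frac1n\log\mathcal{Z}_{n,p}(\beta) \le \inf_{w> 0 }\sup_{z\ge 0 }\left\{\psi_{p}\left(\frac{\sqrt{\beta}\, zw}{(1+z^p)^{1/p}}\right)-\frac1p\log(1+|z|^p)+\frac{2-p}{2p}w^{\frac{2p}{p-2}}\right\}. \]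
   Context: For $p>0$ let $\rho_p(x)=c_p e^{-|x|^p/p}$, $x\in\mathbb{R}$, with $c_p=\frac{p^{-1/p}}{2\Gamma(1+1/p)}$, and $\psi_p(t):=\log\mathbb{E}[e^{tX}]$ for $X\sim\rho_p$. Let $S_{n,p}:=\{\sigma\in\mathbb{R}^n: \frac1n\sum_{i=1}^n|\sigma_i|^p=1\}$ with the uniform probability measure $d_{n,p}\sigma$ (the law of $X/\|X\|_{n,p}$ with $X_1,\dots,X_n$ i.i.d. $\rho_p$, $\|x\|_{n,p}=(\frac1n\sum_i|x_i|^p)^{1/p}$). With $H_n(\sigma)=\frac1n\sum_{i<j}\sigma_i\sigma_j$, the partition function is $\mathcal{Z}_{n,p}(\beta)=\int_{S_{n,p}}\exp(\beta H_n(\sigma))\,d_{n,p}\sigma$. (The limit defining $E_p$ exists for $p>1$.) *)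

theory Defs
  imports "HOL-Probability.Probability"
begin

definition cp :: "real \<Rightarrow> real" where
  "cp p = p powr (-1/p) / (2 * Gamma (1 + 1/p))"

definition rho :: "real \<Rightarrow> real \<Rightarrow> real" where
  "rho p x = cp p * exp (- (\<bar>x\<bar> powr p) / p)"

definition rho_measure :: "real \<Rightarrow> real measure" where
  "rho_measure p = density lborel (\<lambda>x. ennreal (rho p x))"

definition psi :: "real \<Rightarrow> real \<Rightarrow> real" where
  "psi p t = ln (\<integral>x. exp (t * x) \<partial>rho_measure p)"

definition normp :: "nat \<Rightarrow> real \<Rightarrow> (nat \<Rightarrow> real) \<Rightarrow> real" where
  "normp n p x = ((1 / real n) * (\<Sum>i<n. \<bar>x i\<bar> powr p)) powr (1/p)"

definition Ham :: "nat \<Rightarrow> (nat \<Rightarrow> real) \<Rightarrow> real" where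
  "Ham n \<sigma> = (1 / real n) * (\<Sum>j<n. \<Sum>i<j. \<sigma> i * \<sigma> j)"

text \<open>Partition function: integral of exp(beta H_n) against the uniform measure on
  S_{n,p}, i.e. the law of X / ||X||_{n,p} with X_1..X_n iid rho_p.\<close>
definition Zpart :: "nat \<Rightarrow> real \<Rightarrow> real \<Rightarrow> real" where
  "Zpart n p \<beta> =
     (\<integral>x. exp (\<beta> * Ham n (\<lambda>i. x i / normp n p x)) \<partial>(PiM {..<n} (\<lambda>_. rho_measure p)))"

definition Ep :: "real \<Rightarrow> real \<Rightarrow> real" where
  "Ep p \<beta> = lim (\<lambda>n. ln (Zpart n p \<beta>) / real n)"

end

theory Submission
  imports Defs
begin

text \<open>Let \<open>R\<close> be the normalized \<open>p\<close>-norm of \<open>X\<close>, \<open>S = \<Sum> X\<^sub>i\<close> and \<open>m = S/(nR)\<close>, which depends only on the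
  direction of \<open>X\<close>. The probabilities of \<open>{S \<ge> na, R \<le> 1}\<close> are supermultiplicative in \<open>n\<close>, so
  they decay at an exponential rate \<open>J(a)\<close>; as \<open>R\<close> is independent of \<open>m\<close> and lies in
  \<open>[e\<^sup>-\<^sup>\<epsilon>, 1]\<close> with probability at least about \<open>e\<^sup>-\<^sup>n\<^sup>\<epsilon>\<close>, the same rate governs \<open>{m \<ge> a}\<close>. Hence
  \<open>(1/n) ln E exp(n f(|m|))\<close> tends to \<open>sup\<^sub>a (f(a) + J(a))\<close> for increasing continuous \<open>f\<close>.
  The Hamiltonian is \<open>n m\<^sup>2/2\<close> up to \<open>O(n\<^bsup>2/p-1\<^esup>) = o(n)\<close>, so \<open>E\<^sub>p(\<beta>) = sup\<^sub>a (\<beta> a\<^sup>2/2 + J(a))\<close>.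
  After rescaling, the \<open>n\<close>-th power of the exponential of the left-hand expression is
  \<open>E exp(n(\<surd>y z m R - (zR)\<^sup>p/p))\<close>. With \<open>q = p/(p-1)\<close>, Young's inequality and its equality
  case show that both suprema equal \<open>sup\<^sub>a ((\<surd>y a)\<^sup>q/q + J(a))\<close>. The bound on the limit is
  the duality at \<open>y = \<beta> w\<^sup>2\<close>, tested at \<open>x = w\<^bsup>-2\<^esup>\<close>.\<close>

section \<open>Normalization of the density\<close>

text \<open>The change of variables below works on the open half line, where \<open>x powr p\<close>
  is differentiable, while the Gamma integral comes on the closed one.\<close>

lemma has_integral_pos_half_line_iff:
  fixes f :: "real \<Rightarrow> real"
  shows "(f has_integral I) {0<..} \<longleftrightarrow> (f has_integral I) {0..}"
proof (rule has_integral_spike_set_eq)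
  show "negligible {x \<in> {0<..} - {0..}. f x \<noteq> 0}" "negligible {x \<in> {0..} - {0<..}. f x \<noteq> 0}"
    by (rule negligible_subset[of "{0}"]; force)+
qed

text \<open>Substituting t = x^p / p turns the integral into the one defining Gamma(1/p); the
  functional equation of Gamma then gives the shape used in \<open>cp\<close>.\<close>

lemma rho_half_line_integral:
  fixes p :: real
  assumes "p > 0"
  shows "((\<lambda>x. exp (- (x powr p) / p)) has_integral p powr (1/p) * Gamma (1 + 1/p)) {0..}"
proof -
  let ?g = "\<lambda>x::real. x powr p / p"
  \<comment> \<open>This is e^(-t) times the Jacobian dx/dt = (p t)^(1/p - 1) of the inverse x = (p
    t)^(1/p).\<close>
  let ?f = "\<lambda>t::real. p powr (1/p - 1) * (t powr (1/p - 1) / exp t)"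
  have G: "((\<lambda>t. t powr (1/p - 1) / exp t) has_integral Gamma (1/p)) {0..}"
    using Gamma_integral_real[of "1/p"] assms by simp
  have G: "((\<lambda>t. t powr (1/p - 1) / exp t) has_integral Gamma (1/p)) {0<..}"
    using G by (simp only: has_integral_pos_half_line_iff)
  have F: "(?f has_integral p powr (1/p - 1) * Gamma (1/p)) {0<..}"
    by (rule has_integral_mult_right[OF G])
  have img: "?g ` {0<..} = {0<..}"
  proof (intro equalityI subsetI)
    fix t :: real assume "t \<in> {0<..}"
    then have "t = ?g ((p * t) powr (1/p))" "(p * t) powr (1/p) > 0"
      using assms by (auto simp: powr_powr)
    then show "t \<in> ?g ` {0<..}" by (metis greaterThan_iff imageI)
  qed (use assms in auto)
  have Fa: "?f absolutely_integrable_on {0<..}"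
    using F by (intro nonnegative_absolutely_integrable_1) (auto simp: integrable_on_def)
  have "(\<lambda>x. \<bar>x powr (p - 1)\<bar> *\<^sub>R ?f (?g x)) absolutely_integrable_on {0<..} \<and>
      integral {0<..} (\<lambda>x. \<bar>x powr (p - 1)\<bar> *\<^sub>R ?f (?g x)) = p powr (1/p - 1) * Gamma (1/p)"
  proof (subst has_absolute_integral_change_of_variables_real[where g = ?g and f = ?f])
    show "inj_on ?g {0<..}"
      using assms by (intro inj_on_inverseI[where g = "\<lambda>t. (p * t) powr (1/p)"]) (auto simp: powr_powr)
    show "?f absolutely_integrable_on ?g ` {0<..} \<and>
        integral (?g ` {0<..}) ?f = p powr (1/p - 1) * Gamma (1/p)"
      unfolding img using Fa F by (auto intro: integral_unique)
  qed (use assms in \<open>auto intro!: derivative_eq_intros\<close>)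
  moreover have "\<bar>x powr (p - 1)\<bar> *\<^sub>R ?f (?g x) = exp (- (x powr p) / p)" if "x \<in> {0<..}" for x
  proof -
    have "p powr (1/p - 1) * (x powr p / p) powr (1/p - 1) = x powr (1 - p)"
      using that assms by (simp add: powr_divide powr_powr algebra_simps)
    moreover have "x powr (p - 1) * x powr (1 - p) = 1"
      using that by (simp flip: powr_add)
    ultimately show ?thesis
      by (simp add: exp_minus field_simps)
  qed
  ultimately have "((\<lambda>x. exp (- (x powr p) / p)) has_integral p powr (1/p - 1) * Gamma (1/p)) {0<..}"
    by (subst has_integral_cong[where g="\<lambda>x. \<bar>x powr (p - 1)\<bar> *\<^sub>R ?f (?g x)"])
       (auto simp: has_integral_integral dest!: set_lebesgue_integral_eq_integral(1))
  then have "((\<lambda>x. exp (- (x powr p) / p)) has_integral p powr (1/p - 1) * Gamma (1/p)) {0..}"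
    by (simp only: has_integral_pos_half_line_iff)
  moreover have "p powr (1/p - 1) * Gamma (1/p) = p powr (1/p) * Gamma (1 + 1/p)"
    using assms Gamma_plus1[of "1/p"] nonpos_Ints_nonpos[of "1/p"]
    by (cases "1/p \<in> \<int>\<^sub>\<le>\<^sub>0") (auto simp: powr_diff add.commute zero_le_divide_iff divide_le_0_iff)
  ultimately show ?thesis by simp
qed

lemma Gamma_one_plus_inverse_pos: "p > 0 \<Longrightarrow> Gamma (1 + 1 / p) > 0" for p :: real
  by (rule Gamma_real_pos, rule add_pos_pos) simp_all

lemma cp_pos: "p > 0 \<Longrightarrow> cp p > 0"
  unfolding cp_def by (intro divide_pos_pos mult_pos_pos Gamma_one_plus_inverse_pos) auto

text \<open>Reflection makes the two half lines contribute equally, and \<open>cp p\<close> is the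
  reciprocal of their total.\<close>

lemma nn_integral_rho:
  assumes "p > 0"
  shows "(\<integral>\<^sup>+x. ennreal (rho p x) \<partial>lborel) = 1"
proof -
  let ?e = "\<lambda>x. exp (- (\<bar>x\<bar> powr p) / p)"
  let ?I = "p powr (1/p) * Gamma (1 + 1/p)"
  have I: "?I > 0" using assms by (intro mult_pos_pos Gamma_one_plus_inverse_pos) auto
  have R: "(?e has_integral ?I) {0..}"
    by (rule has_integral_eq[OF _ rho_half_line_integral[OF assms]]) auto
  have half: "(\<integral>\<^sup>+x. indicator {0..} x * ennreal (?e x) \<partial>lborel) = ennreal ?I"
    using nn_integral_has_integral_lebesgue'[OF _ R] by (simp add: mult.commute)
  have "(\<integral>\<^sup>+x. indicator {..0} x * ennreal (?e x) \<partial>lborel) =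
      (\<integral>\<^sup>+x. indicator {0..} x * ennreal (?e x) \<partial>lborel)"
    by (subst nn_integral_real_affine[of _ "-1" 0])
       (auto intro!: nn_integral_cong simp: indicator_def)
  \<comment> \<open>Both closed half lines contain 0, so the splitting holds only almost
    everywhere.\<close>
  moreover have "(\<integral>\<^sup>+x. ennreal (?e x) \<partial>lborel) = (\<integral>\<^sup>+x. indicator {0..} x * ennreal (?e x) + indicator {..0} x * ennreal (?e x) \<partial>lborel)"
    by (intro nn_integral_cong_AE eventually_mono[OF AE_lborel_singleton[of 0]]) (auto simp: indicator_def)
  ultimately have "(\<integral>\<^sup>+x. ennreal (?e x) \<partial>lborel) = ennreal (2 * ?I)"
    using half I by (simp add: nn_integral_add flip: ennreal_plus)
  moreover have "cp p * (2 * ?I) = 1"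
  proof -
    have "inverse a / (2 * g) * (2 * (a * g)) = 1" if "a > 0" "g > 0" for a g :: real
      using that by simp
    from this[of "p powr (1/p)" "Gamma (1 + 1/p)"] show ?thesis
      using assms Gamma_one_plus_inverse_pos[of p]
      by (simp add: cp_def powr_minus del: times_divide_eq_left)
  qed
  moreover have "cp p \<ge> 0"
    using cp_pos[OF assms] by simp
  moreover have "(\<integral>\<^sup>+x. ennreal (rho p x) \<partial>lborel) = ennreal (cp p) * (\<integral>\<^sup>+x. ennreal (?e x) \<partial>lborel)"
    unfolding rho_def using cp_pos[OF assms] by (subst nn_integral_cmult[symmetric]) (auto simp: ennreal_mult)
  ultimately show ?thesis
    by (simp flip: ennreal_mult')
qed

section \<open>Scaling of the product measure\<close>

lemma rho_measurable [measurable]: "rho p \<in> borel_measurable borel"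
  unfolding rho_def by measurable

lemma prob_space_rho: "p > 0 \<Longrightarrow> prob_space (rho_measure p)"
  by (rule prob_spaceI) (simp add: rho_measure_def emeasure_density nn_integral_rho)

lemma sets_rho_measure [simp, measurable_cong]: "sets (rho_measure p) = sets borel"
  by (simp add: rho_measure_def)

lemma space_rho_measure [simp]: "space (rho_measure p) = UNIV"
  by (simp add: rho_measure_def)

lemma rho_nonneg: "p > 0 \<Longrightarrow> rho p x \<ge> 0"
  using cp_pos[of p] by (simp add: rho_def)

lemma rho_scale:
  assumes "c \<noteq> 0"
  shows "rho p (x / c) = rho p x * exp ((1 - \<bar>c\<bar> powr (-p)) * \<bar>x\<bar> powr p / p)"
proof -
  have "- (\<bar>x / c\<bar> powr p) / p = - (\<bar>x\<bar> powr p) / p + (1 - \<bar>c\<bar> powr (-p)) * \<bar>x\<bar> powr p / p"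
    using assms by (cases "p = 0") (auto simp: powr_divide powr_minus field_simps)
  then show ?thesis
    by (simp add: rho_def flip: exp_add)
qed

text \<open>The law of cX is given a density relative to the law of X rather than to Lebesgue
  measure, so that the densities of the coordinates multiply to a density relative to the product
  measure. Negative c is included for the reflection c = -1.\<close>

lemma distr_scale_rho:
  assumes "p > 0" "c \<noteq> 0"
  shows "distr (rho_measure p) (rho_measure p) (\<lambda>x. c * x) =
    density (rho_measure p) (\<lambda>x. ennreal (exp ((1 - \<bar>c\<bar> powr (-p)) * \<bar>x\<bar> powr p / p) / \<bar>c\<bar>))"
proof (rule measure_eqI)
  let ?e = "\<lambda>x. exp ((1 - \<bar>c\<bar> powr (-p)) * \<bar>x\<bar> powr p / p) / \<bar>c\<bar>"
  fix A assume "A \<in> sets (distr (rho_measure p) (rho_measure p) (\<lambda>x. c * x))"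
  then have [measurable]: "A \<in> sets borel" by simp
  have "emeasure (distr (rho_measure p) (rho_measure p) (\<lambda>x. c * x)) A =
      (\<integral>\<^sup>+x. indicator A (c * x) \<partial>rho_measure p)"
    by (subst nn_integral_distr[symmetric, where M' = "rho_measure p" and f = "indicator A"]) auto
  also have "\<dots> = (\<integral>\<^sup>+x. ennreal (rho p x) * indicator A (c * x) \<partial>lborel)"
    by (simp add: rho_measure_def nn_integral_density)
  also have "\<dots> = ennreal \<bar>1 / c\<bar> * (\<integral>\<^sup>+x. ennreal (rho p (x / c)) * indicator A x \<partial>lborel)"
    using assms by (subst nn_integral_real_affine[of _ "1 / c" 0]) auto
  also have "\<dots> = (\<integral>\<^sup>+x. ennreal \<bar>1 / c\<bar> * (ennreal (rho p (x / c)) * indicator A x) \<partial>lborel)"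
    by (simp add: nn_integral_cmult)
  also have "\<dots> = (\<integral>\<^sup>+x. ennreal (rho p x) * (ennreal (?e x) * indicator A x) \<partial>lborel)"
    using assms by (intro nn_integral_cong)
      (auto simp: rho_scale rho_nonneg mult_ac indicator_def simp flip: ennreal_mult)
  also have "\<dots> = emeasure (density (rho_measure p) ?e) A"
    by (simp add: rho_measure_def nn_integral_density emeasure_density)
  finally show "emeasure (distr (rho_measure p) (rho_measure p) (\<lambda>x. c * x)) A =
      emeasure (density (rho_measure p) ?e) A" .
qed simp

abbreviation rhoN :: "nat \<Rightarrow> real \<Rightarrow> (nat \<Rightarrow> real) measure" where
  "rhoN n p \<equiv> PiM {..<n} (\<lambda>_. rho_measure p)"

lemma product_prob_space_rho: "p > 0 \<Longrightarrow> product_prob_space (\<lambda>_. rho_measure p)"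
  by (intro product_prob_spaceI prob_space_rho)

lemma prob_space_rhoN: "p > 0 \<Longrightarrow> prob_space (rhoN n p)"
  by (intro prob_space_PiM prob_space_rho)

text \<open>The restriction keeps the scaled vector in the extensional function space that underlies
  \<open>PiM\<close>.\<close>

abbreviation scaleN :: "nat \<Rightarrow> real \<Rightarrow> (nat \<Rightarrow> real) \<Rightarrow> nat \<Rightarrow> real" where
  "scaleN n c x \<equiv> \<lambda>i\<in>{..<n}. c * x i"

lemma sum_powr_eq_normp:
  assumes "n > 0" "p > 0"
  shows "(\<Sum>i<n. \<bar>x i\<bar> powr p) = real n * normp n p x powr p"
  using assms by (simp add: normp_def powr_powr sum_nonneg)

lemma normp_nonneg [simp]: "normp n p x \<ge> 0"
  by (simp add: normp_def)

lemma normp_measurable [measurable]: "normp n p \<in> borel_measurable (rhoN n p)"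
  unfolding normp_def by measurable

lemma normp_scale:
  assumes "p > 0"
  shows "normp n p (scaleN n c x) = \<bar>c\<bar> * normp n p x"
proof -
  have "(\<Sum>i<n. \<bar>scaleN n c x i\<bar> powr p) = \<bar>c\<bar> powr p * (\<Sum>i<n. \<bar>x i\<bar> powr p)"
    unfolding sum_distrib_left by (intro sum.cong) (auto simp: abs_mult powr_mult)
  then have "normp n p (scaleN n c x) = (\<bar>c\<bar> powr p * (1 / real n * (\<Sum>i<n. \<bar>x i\<bar> powr p))) powr (1/p)"
    by (simp add: normp_def)
  also have "\<dots> = (\<bar>c\<bar> powr p) powr (1/p) * normp n p x"
    unfolding normp_def by (subst powr_mult) (auto intro!: sum_nonneg)
  finally show ?thesis using assms by (simp add: powr_powr)
qed

lemma scale_measurable [measurable]: "scaleN n c \<in> rhoN n p \<rightarrow>\<^sub>M rhoN n p"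
  by (intro measurable_restrict) simp

text \<open>The coordinate densities multiply, and their exponents add up to a multiple of the sum
  of |x_i|^p. Hence scaling changes the law only by a function of the norm, which is the source of
  the independence of norm and direction.\<close>

lemma distr_scale_rhoN:
  assumes "p > 0" "c \<noteq> 0" "n > 0"
  shows "distr (rhoN n p) (rhoN n p) (scaleN n c) =
    density (rhoN n p) (\<lambda>x. ennreal (exp (real n * (1 - \<bar>c\<bar> powr (-p)) * normp n p x powr p / p) / \<bar>c\<bar> ^ n))"
    (is "?L = density _ ?d")
proof -
  let ?e = "\<lambda>x::real. exp ((1 - \<bar>c\<bar> powr (-p)) * \<bar>x\<bar> powr p / p) / \<bar>c\<bar>"
  let ?N = "\<lambda>_::nat. density (rho_measure p) (\<lambda>x. ennreal (?e x))"
  interpret R: product_prob_space "\<lambda>_::nat. rho_measure p"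
    using product_prob_space_rho assms by blast
  have N: "?N = (\<lambda>_. distr (rho_measure p) (rho_measure p) (\<lambda>x. c * x))"
    using distr_scale_rho[OF assms(1,2)] by simp
  have "prob_space (distr (rho_measure p) (rho_measure p) (\<lambda>x. c * x))"
    by (intro prob_space.prob_space_distr prob_space_rho assms) simp
  then interpret N: product_prob_space ?N
    unfolding N by (intro product_prob_spaceI)
  have "?L = PiM {..<n} ?N"
    using distr_PiM_finite_prob_space[of "{..<n}" "\<lambda>_. rho_measure p" "\<lambda>_. rho_measure p" "\<lambda>x. c * x"]
      R.product_prob_space_axioms unfolding N
    by (simp add: compose_def[abs_def])
  also have "\<dots> = density (rhoN n p) ?d"
  proof (rule N.PiM_eqI[symmetric])
    fix A :: "nat \<Rightarrow> real set" assume A: "\<And>i. i \<in> {..<n} \<Longrightarrow> A i \<in> sets (?N i)"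
    have [measurable]: "Pi\<^sub>E {..<n} A \<in> sets (rhoN n p)"
      using A by (intro sets_PiM_I_finite) auto
    have "emeasure (density (rhoN n p) ?d) (Pi\<^sub>E {..<n} A) =
        (\<integral>\<^sup>+x. ?d x * indicator (Pi\<^sub>E {..<n} A) x \<partial>rhoN n p)"
      by (rule emeasure_density) auto
    also have "\<dots> = (\<integral>\<^sup>+x. (\<Prod>i<n. ennreal (?e (x i)) * indicator (A i) (x i)) \<partial>rhoN n p)"
    proof (rule nn_integral_cong)
      fix x assume x: "x \<in> space (rhoN n p)"
      have "?d x = (\<Prod>i<n. ennreal (?e (x i)))"
      proof -
        have "exp (real n * (1 - \<bar>c\<bar> powr (-p)) * normp n p x powr p / p) =
            exp (\<Sum>i<n. (1 - \<bar>c\<bar> powr (-p)) * \<bar>x i\<bar> powr p / p)"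
          using assms unfolding sum_divide_distrib[symmetric] sum_distrib_left[symmetric]
          by (simp add: sum_powr_eq_normp mult_ac)
        also have "\<dots> = (\<Prod>i<n. exp ((1 - \<bar>c\<bar> powr (-p)) * \<bar>x i\<bar> powr p / p))"
          by (rule exp_sum) simp
        finally show ?thesis
          by (simp add: prod_ennreal prod_dividef)
      qed
      moreover have "indicator (Pi\<^sub>E {..<n} A) x = (\<Prod>i<n. indicator (A i) (x i) :: ennreal)"
        using x by (auto simp: indicator_def space_PiM PiE_def Pi_iff prod_zero_iff)
      ultimately show "?d x * indicator (Pi\<^sub>E {..<n} A) x =
          (\<Prod>i<n. ennreal (?e (x i)) * indicator (A i) (x i))"
        by (simp add: prod.distrib)
    qed
    also have "\<dots> = (\<Prod>i<n. \<integral>\<^sup>+x. ennreal (?e x) * indicator (A i) x \<partial>rho_measure p)"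
      using A by (intro R.product_nn_integral_prod) auto
    also have "\<dots> = (\<Prod>i<n. emeasure (?N i) (A i))"
      using A by (intro prod.cong refl emeasure_density[symmetric]) auto
    finally show "emeasure (density (rhoN n p) ?d) (Pi\<^sub>E {..<n} A) = (\<Prod>i<n. emeasure (?N i) (A i))" .
  qed (auto intro!: sets_PiM_cong)
  finally show ?thesis .
qed

lemma nn_integral_scale_rhoN:
  assumes "p > 0" "c \<noteq> 0" "n > 0" and [measurable]: "g \<in> borel_measurable (rhoN n p)"
  shows "(\<integral>\<^sup>+x. g (scaleN n c x) \<partial>rhoN n p) =
    (\<integral>\<^sup>+x. ennreal (exp (real n * (1 - \<bar>c\<bar> powr (-p)) * normp n p x powr p / p) / \<bar>c\<bar> ^ n) * g x \<partial>rhoN n p)"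
proof -
  have "(\<integral>\<^sup>+x. g (scaleN n c x) \<partial>rhoN n p) = integral\<^sup>N (distr (rhoN n p) (rhoN n p) (scaleN n c)) g"
    by (subst nn_integral_distr) auto
  also have "\<dots> = (\<integral>\<^sup>+x. ennreal (exp (real n * (1 - \<bar>c\<bar> powr (-p)) * normp n p x powr p / p) / \<bar>c\<bar> ^ n) * g x \<partial>rhoN n p)"
    unfolding distr_scale_rhoN[OF assms(1-3)] by (rule nn_integral_density) auto
  finally show ?thesis .
qed

section \<open>Independence of norm and direction\<close>

lemma AE_rho_nonzero: "AE x in rho_measure p. x \<noteq> 0"
  unfolding rho_measure_def
  by (subst AE_density) (auto intro: eventually_mono[OF AE_lborel_singleton[of 0]])

lemma AE_normp_pos:
  assumes "p > 0" "n > 0"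
  shows "AE x in rhoN n p. normp n p x > 0"
proof -
  interpret product_prob_space "\<lambda>_::nat. rho_measure p"
    using product_prob_space_rho assms by blast
  have "AE x in rhoN n p. x 0 \<noteq> 0"
    using assms AE_rho_nonzero[of p]
    by (intro AE_PiM_component[where P = "\<lambda>x. x \<noteq> 0"] prob_space_rho) auto
  then show ?thesis
  proof eventually_elim
    case (elim x)
    have "0 < \<bar>x 0\<bar> powr p" using elim by simp
    also have "\<dots> \<le> (\<Sum>i<n. \<bar>x i\<bar> powr p)"
      using assms by (intro member_le_sum) auto
    finally show ?case
      using assms by (simp add: normp_def)
  qed
qed

text \<open>Unnormalized law of the norm R in the coordinate s = ln R: it is the weight r^(n-1)
  exp(-n r^p / p) dr after putting r = e^s.\<close>

definition radial :: "nat \<Rightarrow> real \<Rightarrow> (real \<Rightarrow> ennreal) \<Rightarrow> ennreal" where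
  "radial n p w = (\<integral>\<^sup>+s. w (exp s) * ennreal (exp (real n * (s - exp (p * s) / p))) \<partial>lborel)"

text \<open>Under \<^term>\<open>rhoN n p\<close> the direction and the norm are independent: insert
  \<open>\<integral> k(e\<^sup>t |x|) dt = 1\<close> and rescale.\<close>

lemma polar_factorization:
  assumes p: "p > 0" and n: "n > 0" and [measurable]: "h \<in> borel_measurable (rhoN n p)"
    and hom: "\<And>c x. c > 0 \<Longrightarrow> x \<in> space (rhoN n p) \<Longrightarrow> h (scaleN n c x) = h x"
  obtains B where "\<And>w. w \<in> borel_measurable borel \<Longrightarrow>
    (\<integral>\<^sup>+x. h x * w (normp n p x) \<partial>rhoN n p) = B * radial n p w"
proof
  \<comment> \<open>In the coordinate ln r this is the indicator of [0, 1], so its integral over all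
    dilates e^t r is 1.\<close>
  define k :: "real \<Rightarrow> ennreal" where "k = indicator {1..exp 1}"
  have [measurable]: "k \<in> borel_measurable borel" unfolding k_def by simp
  define B where "B = (\<integral>\<^sup>+x. h x * k (normp n p x) *
    ennreal (exp (real n * (normp n p x powr p / p - ln (normp n p x)))) \<partial>rhoN n p)"
  fix w :: "real \<Rightarrow> ennreal" assume [measurable]: "w \<in> borel_measurable borel"
  interpret P: prob_space "rhoN n p" using prob_space_rhoN p by blast
  interpret pair_sigma_finite lborel "rhoN n p" ..
  let ?R = "normp n p"
  let ?g = "\<lambda>t x. ennreal (exp (real n * (1 - \<bar>exp t\<bar> powr (-p)) * ?R x powr p / p) / \<bar>exp t\<bar> ^ n) *
    (h x * w (exp (-t) * ?R x) * k (?R x))"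
  have unit: "(\<integral>\<^sup>+t. k (exp t * r) \<partial>lborel) = 1" if "r > 0" for r
  proof -
    have "(\<integral>\<^sup>+t. k (exp t * r) \<partial>lborel) = (\<integral>\<^sup>+t. k (exp t) \<partial>lborel)"
      using that by (subst (2) nn_integral_real_affine[of _ 1 "ln r"]) (auto simp: exp_add mult.commute)
    also have "\<dots> = (\<integral>\<^sup>+t. indicator {0..1::real} t \<partial>lborel)"
      by (auto intro!: nn_integral_cong simp: k_def indicator_def)
    finally show ?thesis by simp
  qed
  have "(\<integral>\<^sup>+x. h x * w (?R x) \<partial>rhoN n p) =
      (\<integral>\<^sup>+x. (\<integral>\<^sup>+t. h x * w (?R x) * k (exp t * ?R x) \<partial>lborel) \<partial>rhoN n p)"
    by (intro nn_integral_cong_AE eventually_mono[OF AE_normp_pos[OF p n]])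
       (simp add: nn_integral_cmult unit)
  also have "\<dots> = (\<integral>\<^sup>+t. (\<integral>\<^sup>+x. h x * w (?R x) * k (exp t * ?R x) \<partial>rhoN n p) \<partial>lborel)"
    by (rule Fubini') measurable
  also have "\<dots> = (\<integral>\<^sup>+t. (\<integral>\<^sup>+x. ?g t x \<partial>rhoN n p) \<partial>lborel)"
  proof (rule nn_integral_cong)
    fix t :: real
    have "(\<integral>\<^sup>+x. h x * w (?R x) * k (exp t * ?R x) \<partial>rhoN n p) =
        (\<integral>\<^sup>+x. (\<lambda>x. h x * w (exp (-t) * ?R x) * k (?R x)) (scaleN n (exp t) x) \<partial>rhoN n p)"
      using p by (intro nn_integral_cong) (simp add: normp_scale hom flip: mult.assoc exp_add)
    also have "\<dots> = (\<integral>\<^sup>+x. ?g t x \<partial>rhoN n p)"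
      by (rule nn_integral_scale_rhoN) (use p n in auto)
    finally show "(\<integral>\<^sup>+x. h x * w (?R x) * k (exp t * ?R x) \<partial>rhoN n p) = (\<integral>\<^sup>+x. ?g t x \<partial>rhoN n p)" .
  qed
  also have "\<dots> = (\<integral>\<^sup>+x. (\<integral>\<^sup>+t. ?g t x \<partial>lborel) \<partial>rhoN n p)"
    by (rule Fubini'[symmetric]) measurable
  also have "\<dots> = (\<integral>\<^sup>+x. h x * k (?R x) * ennreal (exp (real n * (?R x powr p / p - ln (?R x)))) *
      radial n p w \<partial>rhoN n p)"
  proof (intro nn_integral_cong_AE eventually_mono[OF AE_normp_pos[OF p n]])
    fix x assume R: "?R x > 0"
    define r where "r = ln (?R x)"
    have Rr: "?R x = exp r" using R by (simp add: r_def)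
    let ?c = "h x * k (exp r) * ennreal (exp (real n * (exp (p * r) / p - r)))"
    \<comment> \<open>With s = r - t the scaling density splits into a factor in x alone and the
      weight of \<open>radial\<close> at s, so integrating over t gives a value that does not depend
      on x.\<close>
    have "?g t x = ?c * (w (exp (r - t)) * ennreal (exp (real n * ((r - t) - exp (p * (r - t)) / p))))" for t
    proof -
      have "exp (real n * (1 - \<bar>exp t\<bar> powr (-p)) * exp r powr p / p) / \<bar>exp t\<bar> ^ n =
          exp (real n * (1 - exp (- (p * t))) * exp (p * r) / p - real n * t)"
        using exp_of_nat_mult[of n t] by (simp add: powr_def exp_diff)
      also have "real n * (1 - exp (- (p * t))) * exp (p * r) / p - real n * t =
          real n * (exp (p * r) / p - r) + real n * ((r - t) - exp (p * (r - t)) / p)"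
        using p by (simp add: field_simps flip: exp_add)
      finally have E: "exp (real n * (1 - \<bar>exp t\<bar> powr (-p)) * exp r powr p / p) / \<bar>exp t\<bar> ^ n =
          exp (real n * (exp (p * r) / p - r)) * exp (real n * ((r - t) - exp (p * (r - t)) / p))"
        unfolding exp_add .
      have "exp (-t) * exp r = exp (r - t)" by (simp flip: exp_add)
      then show ?thesis
        unfolding Rr E by (simp only: ennreal_mult exp_ge_zero mult_ac)
    qed
    then have "(\<integral>\<^sup>+t. ?g t x \<partial>lborel) =
        ?c * (\<integral>\<^sup>+t. w (exp (r - t)) * ennreal (exp (real n * ((r - t) - exp (p * (r - t)) / p))) \<partial>lborel)"
      by (simp add: nn_integral_cmult)
    also have "(\<integral>\<^sup>+t. w (exp (r - t)) * ennreal (exp (real n * ((r - t) - exp (p * (r - t)) / p))) \<partial>lborel) = radial n p w"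
      unfolding radial_def by (subst (2) nn_integral_real_affine[of _ "-1" r]) auto
    finally show "(\<integral>\<^sup>+t. ?g t x \<partial>lborel) =
        h x * k (?R x) * ennreal (exp (real n * (?R x powr p / p - ln (?R x)))) * radial n p w"
      by (simp add: Rr powr_def)
  qed
  also have "\<dots> = B * radial n p w"
    unfolding B_def by (rule nn_integral_multc) measurable
  finally show "(\<integral>\<^sup>+x. h x * w (?R x) \<partial>rhoN n p) = B * radial n p w" .
qed

lemma radial_exponent_le:
  fixes p s :: real
  assumes "p > 0"
  shows "s - exp (p * s) / p \<le> - (1 / p)"
  using divide_right_mono[OF exp_ge_add_one_self[of "p * s"], of p] assms by (simp add: add_divide_distrib)

text \<open>The exponent s - e^(ps)/p has maximum -1/p, at s = 0, and loses at most e on the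
  interval from -e to 0.\<close>

lemma radial_window_ge:
  assumes "p > 0" "e > 0"
  shows "radial n p (indicator {exp (-e)..1}) \<ge> ennreal (e * exp (- real n * (e + 1 / p)))"
proof -
  have "ennreal (e * exp (- real n * (e + 1 / p))) =
      (\<integral>\<^sup>+s. ennreal (exp (- real n * (e + 1 / p))) * indicator {-e..0} s \<partial>lborel)"
    using assms by (subst nn_integral_cmult_indicator) (auto simp: ennreal_mult mult.commute)
  also have "\<dots> \<le> radial n p (indicator {exp (-e)..1})"
    unfolding radial_def
  proof (rule nn_integral_mono)
    fix s :: real
    have "- real n * (e + 1 / p) \<le> real n * (s - exp (p * s) / p)" if "-e \<le> s" "s \<le> 0"
    proof -
      have "exp (p * s) / p \<le> 1 / p"
        using that assms by (intro divide_right_mono) (auto simp: mult_nonneg_nonpos)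
      then have "real n * (- (e + 1 / p)) \<le> real n * (s - exp (p * s) / p)"
        using that by (intro mult_left_mono) auto
      then show ?thesis by (simp only: mult_minus_left mult_minus_right)
    qed
    then show "ennreal (exp (- real n * (e + 1 / p))) * indicator {-e..0} s \<le>
        indicator {exp (-e)..1} (exp s) * ennreal (exp (real n * (s - exp (p * s) / p)))"
      by (auto simp: indicator_def intro!: ennreal_leI)
  qed
  finally show ?thesis .
qed

text \<open>The total mass 1 factors as B times this integral. An infinite value would make the
  product 0 or infinity, hence never 1.\<close>

lemma radial_one_finite:
  assumes "p > 0"
  shows "radial 1 p (\<lambda>_. 1) < \<infinity>"
proof -
  interpret prob_space "rhoN 1 p" using prob_space_rhoN assms by blast
  obtain B where B: "\<And>w. w \<in> borel_measurable borel \<Longrightarrow>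
      (\<integral>\<^sup>+x. 1 * w (normp 1 p x) \<partial>rhoN 1 p) = B * radial 1 p w"
    using polar_factorization[OF assms, of 1 "\<lambda>_. 1"] by auto
  have "1 = B * radial 1 p (\<lambda>_. 1)"
    using B[of "\<lambda>_. 1"] emeasure_space_1 by simp
  then have "radial 1 p (\<lambda>_. 1) \<noteq> \<infinity>"
    by (cases "B = 0") (auto simp: ennreal_mult_top)
  then show ?thesis by (simp add: less_top)
qed

text \<open>Of the n copies of the exponent, n - 1 are bounded by the maximum -1/p and the last one
  is kept for integrability, which leaves the case n = 1.\<close>

lemma radial_le:
  assumes "p > 0" "n > 0"
  shows "radial n p (\<lambda>_. 1) \<le> ennreal (exp (- (real n - 1) / p)) * radial 1 p (\<lambda>_. 1)"
proof -
  have "radial n p (\<lambda>_. 1) \<le> (\<integral>\<^sup>+s. ennreal (exp (- (real n - 1) / p)) *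
      ennreal (exp (s - exp (p * s) / p)) \<partial>lborel)"
    unfolding radial_def
  proof (rule nn_integral_mono)
    fix s :: real
    have "(real n - 1) * (s - exp (p * s) / p) \<le> (real n - 1) * (- (1 / p))"
      using assms by (intro mult_left_mono radial_exponent_le) auto
    then have "real n * (s - exp (p * s) / p) \<le> - (real n - 1) / p + (s - exp (p * s) / p)"
      using left_diff_distrib[of "real n" 1 "s - exp (p * s) / p"]
      by (simp only: mult_minus_right mult_1 times_divide_eq_right mult_1_right minus_divide_left[symmetric])
    then show "1 * ennreal (exp (real n * (s - exp (p * s) / p))) \<le>
        ennreal (exp (- (real n - 1) / p)) * ennreal (exp (s - exp (p * s) / p))"
      by (simp flip: ennreal_mult exp_add)
  qed
  also have "\<dots> = ennreal (exp (- (real n - 1) / p)) * radial 1 p (\<lambda>_. 1)"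
    unfolding radial_def by (simp add: nn_integral_cmult)
  finally show ?thesis .
qed

text \<open>For a cone C, independence makes the ratio of the two probabilities equal to a ratio of
  radial integrals. The factors exp(-n/p) of their bounds cancel, so confining the norm to the
  window costs only K/e times exp(n e).\<close>

lemma cone_measure_le_window:
  assumes p: "p > 0"
  obtains K where "K > 0" "\<And>n e C. n > 0 \<Longrightarrow> e > 0 \<Longrightarrow> C \<in> sets (rhoN n p) \<Longrightarrow>
    (\<And>c x. c > 0 \<Longrightarrow> x \<in> space (rhoN n p) \<Longrightarrow> scaleN n c x \<in> C \<longleftrightarrow> x \<in> C) \<Longrightarrow>
    measure (rhoN n p) C \<le> K / e * exp (real n * e) *
      measure (rhoN n p) (C \<inter> {x \<in> space (rhoN n p). exp (-e) \<le> normp n p x \<and> normp n p x \<le> 1})"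
proof
  define J where "J = enn2real (radial 1 p (\<lambda>_. 1))"
  have J: "radial 1 p (\<lambda>_. 1) = ennreal J" "J \<ge> 0"
    using radial_one_finite[OF p] by (auto simp: J_def)
  \<comment> \<open>Using J + 1 instead of J gives a positive constant at once; exp(1/p) makes up
    for the copy of the exponent kept in \<open>radial_le\<close>.\<close>
  show "(J + 1) * exp (1 / p) > 0" using J by simp
  fix n :: nat and e :: real and C
  assume n: "n > 0" and e: "e > 0" and [measurable]: "C \<in> sets (rhoN n p)"
    and cone: "\<And>c x. c > 0 \<Longrightarrow> x \<in> space (rhoN n p) \<Longrightarrow> scaleN n c x \<in> C \<longleftrightarrow> x \<in> C"
  interpret prob_space "rhoN n p" using prob_space_rhoN p by blast
  let ?D = "C \<inter> {x \<in> space (rhoN n p). exp (-e) \<le> normp n p x \<and> normp n p x \<le> 1}"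
  obtain B where B: "\<And>w. w \<in> borel_measurable borel \<Longrightarrow>
      (\<integral>\<^sup>+x. indicator C x * w (normp n p x) \<partial>rhoN n p) = B * radial n p w"
    using polar_factorization[OF p n, of "indicator C"] cone by (auto simp: indicator_def)
  have BC: "emeasure (rhoN n p) C = B * radial n p (\<lambda>_. 1)"
    using B[of "\<lambda>_. 1"] by simp
  have "emeasure (rhoN n p) ?D = (\<integral>\<^sup>+x. indicator C x * indicator {exp (-e)..1} (normp n p x) \<partial>rhoN n p)"
    by (subst nn_integral_indicator[symmetric])
       (auto intro!: nn_integral_cong simp: indicator_def simp del: nn_integral_indicator)
  also have "\<dots> = B * radial n p (indicator {exp (-e)..1})"
    by (rule B) simp
  finally have BD: "emeasure (rhoN n p) ?D = B * radial n p (indicator {exp (-e)..1})" .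
  have "ennreal (e * exp (- real n * (e + 1 / p))) * emeasure (rhoN n p) C \<le>
      radial n p (indicator {exp (-e)..1}) * (B * radial n p (\<lambda>_. 1))"
    unfolding BC by (intro mult_right_mono radial_window_ge p e) auto
  also have "\<dots> = emeasure (rhoN n p) ?D * radial n p (\<lambda>_. 1)"
    unfolding BD by (simp add: mult_ac)
  also have "\<dots> \<le> emeasure (rhoN n p) ?D * (ennreal (exp (- (real n - 1) / p)) * ennreal J)"
    using radial_le[OF p n] unfolding J by (intro mult_left_mono) auto
  finally have "e * exp (- real n * (e + 1 / p)) * prob C \<le> prob ?D * (exp (- (real n - 1) / p) * J)"
    using e J by (simp add: emeasure_eq_measure flip: ennreal_mult)
  also have "\<dots> \<le> prob ?D * (exp (- (real n - 1) / p) * (J + 1))"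
    by (intro mult_left_mono) auto
  finally have *: "e * exp (- real n * (e + 1 / p)) * prob C \<le> prob ?D * (exp (- (real n - 1) / p) * (J + 1))" .
  have "prob C = e * exp (- real n * (e + 1 / p)) * prob C * (exp (real n * (e + 1 / p)) / e)"
    using e by (simp add: exp_minus)
  also have "\<dots> \<le> prob ?D * (exp (- (real n - 1) / p) * (J + 1)) * (exp (real n * (e + 1 / p)) / e)"
    using e by (intro mult_right_mono[OF *]) auto
  also have "\<dots> = (J + 1) * (exp (- (real n - 1) / p) * exp (real n * (e + 1 / p))) / e * prob ?D"
    by (simp add: mult_ac)
  also have "exp (- (real n - 1) / p) * exp (real n * (e + 1 / p)) = exp (1 / p) * exp (real n * e)"
    using p by (simp add: field_simps flip: exp_add)
  finally show "prob C \<le> (J + 1) * exp (1 / p) / e * exp (real n * e) * prob ?D"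
    by (simp add: mult_ac)
qed

section \<open>Fekete's lemma\<close>

text \<open>The supremum bounds every quotient from above. From below, n is divided by a fixed k
  whose quotient is nearly optimal; the remainder costs a constant, which disappears after division
  by n.\<close>

lemma fekete_superadditive:
  fixes u :: "nat \<Rightarrow> real"
  assumes super: "\<And>m n. u m + u n \<le> u (m + n)" and nonpos: "\<And>n. u n \<le> 0" and zero: "u 0 = 0"
  shows "(\<lambda>n. u n / real n) \<longlonglongrightarrow> (SUP n\<in>{0<..}. u n / real n)"
proof -
  let ?L = "SUP n\<in>{0<..}. u n / real n"
  have bdd: "bdd_above ((\<lambda>n. u n / real n) ` {0<..})"
    using nonpos by (intro bdd_aboveI[of _ 0]) (auto simp: divide_nonpos_nonneg)
  have le: "u n / real n \<le> ?L" if "n > 0" for n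
    using that by (intro cSUP_upper bdd) auto
  have mult: "real q * u k \<le> u (q * k)" for q k
  proof (induction q)
    case 0
    then show ?case by (simp add: zero)
  next
    case (Suc q)
    then show ?case using super[of k "q * k"] by (simp add: algebra_simps)
  qed
  show ?thesis
  proof (rule order_tendstoI)
    fix a assume "a > ?L"
    then show "\<forall>\<^sub>F n in sequentially. u n / real n < a"
      by (intro eventually_sequentiallyI[of 1] le_less_trans[OF le]) auto
  next
    fix a assume "a < ?L"
    then obtain k where k: "k > 0" "a < u k / real k"
      using less_cSUP_iff[OF _ bdd] by auto
    have lower: "u k / real k + real k * u 1 / real n \<le> u n / real n" if n: "n > 0" for n
    proof -
      \<comment> \<open>Since u k is nonpositive, rounding n/k down can only increase the
        product.\<close>
      have "real n / real k * u k \<le> real (n div k) * u k"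
        using nonpos[of k] k of_nat_div_le_of_nat[of n k] by (intro mult_right_mono_neg) auto
      also have "\<dots> \<le> u (n div k * k)" by (rule mult)
      finally have 1: "real n / real k * u k \<le> u (n div k * k)" .
      \<comment> \<open>The remainder is below k and u 1 is nonpositive, so k * u 1 is a lower bound
        independent of n.\<close>
      have "real k * u 1 \<le> real (n mod k) * u 1"
        using nonpos[of 1] k by (intro mult_right_mono_neg) (auto simp: less_imp_le)
      also have "\<dots> \<le> u (n mod k)" using mult[of "n mod k" 1] by simp
      finally have "real n / real k * u k + real k * u 1 \<le> u n"
        using 1 super[of "n div k * k" "n mod k"] by simp
      then have "(real n / real k * u k + real k * u 1) / real n \<le> u n / real n"
        by (intro divide_right_mono) auto
      then show ?thesis using n by (simp add: add_divide_distrib)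
    qed
    have "(\<lambda>n. u k / real k + real k * u 1 / real n) \<longlonglongrightarrow> u k / real k + 0"
      by (intro tendsto_intros lim_const_over_n)
    then have "\<forall>\<^sub>F n in sequentially. a < u k / real k + real k * u 1 / real n"
      using k by (intro order_tendstoD) auto
    then show "\<forall>\<^sub>F n in sequentially. a < u n / real n"
      using eventually_gt_at_top[of 0]
      by eventually_elim (rule less_le_trans[OF _ lower])
  qed
qed

section \<open>Supermultiplicative tails\<close>

text \<open>Both constraints are written with sums, so that they add up when vectors are
  concatenated. For positive n and p the second one says that the normalized norm is at most
  1.\<close>

definition tail_set :: "nat \<Rightarrow> real \<Rightarrow> real \<Rightarrow> (nat \<Rightarrow> real) set" where
  "tail_set n p a = {x \<in> space (rhoN n p). real n * a \<le> (\<Sum>i<n. x i) \<and> (\<Sum>i<n. \<bar>x i\<bar> powr p) \<le> real n}"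

definition tail :: "real \<Rightarrow> real \<Rightarrow> nat \<Rightarrow> real" where
  "tail p a n = measure (rhoN n p) (tail_set n p a)"

lemma tail_set_measurable [measurable]: "tail_set n p a \<in> sets (rhoN n p)"
  unfolding tail_set_def by measurable

lemma tail_le_1: "p > 0 \<Longrightarrow> tail p a n \<le> 1"
  unfolding tail_def using prob_space.prob_le_1[OF prob_space_rhoN] by blast

lemma tail_0: "p > 0 \<Longrightarrow> tail p a 0 = 1"
  using prob_space.prob_space[OF prob_space_rhoN[of p 0]] by (simp add: tail_def tail_set_def)

text \<open>Concatenating independent vectors from the two tail sets gives a vector in the tail set
  of length m + k.\<close>

lemma tail_superadditive:
  assumes p: "p > 0"
  shows "tail p a m * tail p a k \<le> tail p a (m + k)"
proof -
  interpret product_prob_space "\<lambda>_::nat. rho_measure p"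
    using product_prob_space_rho p by blast
  interpret mk: prob_space "rhoN (m + k) p" using prob_space_rhoN p by blast
  interpret m: prob_space "rhoN m p" using prob_space_rhoN p by blast
  interpret k: prob_space "rhoN k p" using prob_space_rhoN p by blast
  \<comment> \<open>The second block lives on shifted indices because \<open>merge\<close> joins
    families over disjoint index sets; \<open>?shift\<close> renames them back.\<close>
  let ?J = "{m..<m + k}"
  let ?M = "PiM ?J (\<lambda>_. rho_measure p)"
  interpret J: prob_space ?M by (intro prob_space_PiM prob_space_rho p)
  let ?shift = "\<lambda>x. \<lambda>i\<in>{..<k}. x (m + i)"
  let ?B = "?shift -` tail_set k p a \<inter> space ?M"
  have [measurable]: "?shift \<in> ?M \<rightarrow>\<^sub>M rhoN k p"
    by (intro measurable_restrict measurable_component_singleton) auto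
  have distr: "distr ?M (rhoN k p) ?shift = rhoN k p"
    using distr_PiM_reindex[of ?J "\<lambda>_. rho_measure p" "\<lambda>i. m + i" "{..<k}"] prob_space_rho[OF p]
    by (simp add: Pi_iff)
  have B: "emeasure ?M ?B = emeasure (rhoN k p) (tail_set k p a)"
    using arg_cong[OF distr, of "\<lambda>M. emeasure M (tail_set k p a)"] by (simp add: emeasure_distr)
  have un: "{..<m} \<union> ?J = {..<m + k}" by auto
  have [measurable]: "merge {..<m} ?J \<in> (rhoN m p \<Otimes>\<^sub>M ?M) \<rightarrow>\<^sub>M rhoN (m + k) p"
    using measurable_merge[of "{..<m}" ?J "\<lambda>_. rho_measure p"] unfolding un .
  have sub: "tail_set m p a \<times> ?B \<subseteq> merge {..<m} ?J -` tail_set (m + k) p a \<inter> space (rhoN m p \<Otimes>\<^sub>M ?M)"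
  proof
    fix xy assume "xy \<in> tail_set m p a \<times> ?B"
    then obtain x y where xy: "xy = (x, y)" and x: "x \<in> tail_set m p a"
      and y: "?shift y \<in> tail_set k p a" "y \<in> space ?M" by auto
    let ?z = "merge {..<m} ?J (x, y)"
    have split: "(\<Sum>i<m + k. f (?z i)) = (\<Sum>i<m. f (x i)) + (\<Sum>i<k. f (y (m + i)))" for f :: "real \<Rightarrow> real"
    proof -
      have "(\<Sum>i<m + k. f (?z i)) = (\<Sum>i<m. f (?z i)) + (\<Sum>i\<in>?J. f (?z i))"
        unfolding un[symmetric] by (rule sum.union_disjoint) auto
      also have "(\<Sum>i<m. f (?z i)) = (\<Sum>i<m. f (x i))" by (intro sum.cong) (auto simp: merge_def)
      also have "(\<Sum>i\<in>?J. f (?z i)) = (\<Sum>i\<in>?J. f (y i))" by (intro sum.cong) (auto simp: merge_def)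
      also have "\<dots> = (\<Sum>i<k. f (y (m + i)))"
        by (rule sum.reindex_bij_witness[of _ "\<lambda>i. m + i" "\<lambda>i. i - m"]) auto
      finally show ?thesis .
    qed
    have "?z \<in> space (rhoN (m + k) p)"
      by (auto simp: space_PiM PiE_def extensional_def merge_def)
    then have "?z \<in> tail_set (m + k) p a"
      using x y split[of "\<lambda>x. x"] split[of "\<lambda>x. \<bar>x\<bar> powr p"] 
      by (auto simp: tail_set_def algebra_simps)
    then show "xy \<in> merge {..<m} ?J -` tail_set (m + k) p a \<inter> space (rhoN m p \<Otimes>\<^sub>M ?M)"
      using x y by (simp add: xy tail_set_def space_pair_measure)
  qed
  have "emeasure (rhoN m p) (tail_set m p a) * emeasure (rhoN k p) (tail_set k p a) =
      emeasure (rhoN m p \<Otimes>\<^sub>M ?M) (tail_set m p a \<times> ?B)"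
    unfolding B[symmetric] by (rule J.emeasure_pair_measure_Times[symmetric]) auto
  also have "\<dots> \<le> emeasure (rhoN m p \<Otimes>\<^sub>M ?M) (merge {..<m} ?J -` tail_set (m + k) p a \<inter> space (rhoN m p \<Otimes>\<^sub>M ?M))"
    by (intro emeasure_mono sub) measurable
  also have "\<dots> = emeasure (distr (rhoN m p \<Otimes>\<^sub>M ?M) (rhoN (m + k) p) (merge {..<m} ?J)) (tail_set (m + k) p a)"
    by (simp add: emeasure_distr)
  also have "distr (rhoN m p \<Otimes>\<^sub>M ?M) (rhoN (m + k) p) (merge {..<m} ?J) = rhoN (m + k) p"
    using distr_merge[of "{..<m}" ?J] un by (simp add: ivl_disj_int)
  finally show ?thesis
    unfolding tail_def m.emeasure_eq_measure k.emeasure_eq_measure mk.emeasure_eq_measure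
    by (simp flip: ennreal_mult)
qed

text \<open>For one coordinate the event contains the interval from a to 1. It has positive length
  as a < 1, and the density is bounded below on it.\<close>

lemma tail_1_pos:
  assumes p: "p > 0" and a: "0 \<le> a" "a < 1"
  shows "tail p a 1 > 0"
proof -
  interpret product_prob_space "\<lambda>_::nat. rho_measure p"
    using product_prob_space_rho p by blast
  interpret R1: prob_space "rhoN 1 p" using prob_space_rhoN p by blast
  have "0 < ennreal (cp p * exp (- (1 / p))) * emeasure lborel {a..1}"
    using a cp_pos[OF p] by (simp add: ennreal_zero_less_mult_iff)
  also have "\<dots> = (\<integral>\<^sup>+x. ennreal (cp p * exp (- (1 / p))) * indicator {a..1} x \<partial>lborel)"
    by (simp add: nn_integral_cmult_indicator)
  also have "\<dots> \<le> (\<integral>\<^sup>+x. ennreal (rho p x) * indicator {a..1} x \<partial>lborel)"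
  proof (rule nn_integral_mono)
    fix x
    show "ennreal (cp p * exp (- (1 / p))) * indicator {a..1} x \<le> ennreal (rho p x) * indicator {a..1} x"
    proof (cases "x \<in> {a..1}")
      case True
      then have "\<bar>x\<bar> powr p \<le> 1" using a p powr_mono2[of p "\<bar>x\<bar>" 1] by simp
      then show ?thesis
        using p cp_pos[OF p] True
        by (auto simp: rho_def divide_right_mono intro!: ennreal_leI mult_left_mono)
    qed simp
  qed
  also have "\<dots> = emeasure (rho_measure p) {a..1}"
    by (simp add: rho_measure_def emeasure_density)
  also have "\<dots> = emeasure (rhoN 1 p) (PiE {..<1} (\<lambda>_. {a..1}))"
    by (subst emeasure_PiM) (auto simp: lessThan_Suc)
  also have "\<dots> \<le> emeasure (rhoN 1 p) (tail_set 1 p a)"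
    using a p powr_mono2[of p _ 1]
    by (intro emeasure_mono tail_set_measurable) (auto simp: tail_set_def space_PiM PiE_def Pi_def)
  finally show ?thesis
    unfolding tail_def R1.emeasure_eq_measure by simp
qed

lemma tail_pos:
  assumes p: "p > 0" and a: "0 \<le> a" "a < 1"
  shows "tail p a n > 0"
proof (induction n)
  case (Suc n)
  then show ?case
    using tail_superadditive[OF p, of a n 1] tail_1_pos[OF assms]
    by (metis Suc_eq_plus1 less_le_trans mult_pos_pos)
qed (simp add: tail_0 p)

text \<open>The exponential rate J of the overview. By Fekete's lemma the supremum is also the limit
  for 0 \<le> a < 1, and as a supremum it bounds the tail at every n, not only
  asymptotically.\<close>

definition rate :: "real \<Rightarrow> real \<Rightarrow> real" where
  "rate p a = (SUP n\<in>{0<..}. ln (tail p a n) / real n)"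

context
  fixes p a :: real
  assumes p: "p > 0" and a: "0 \<le> a" "a < 1"
begin

lemma ln_tail_nonpos: "ln (tail p a n) \<le> 0"
  using tail_le_1[OF p] tail_pos[OF p a] by (simp add: ln_le_zero_iff)

lemma tail_limit: "(\<lambda>n. ln (tail p a n) / real n) \<longlonglongrightarrow> rate p a"
  unfolding rate_def
proof (rule fekete_superadditive)
  show "ln (tail p a m) + ln (tail p a n) \<le> ln (tail p a (m + n))" for m n
    using tail_superadditive[OF p] tail_pos[OF p a] by (subst ln_mult_pos[symmetric]) (auto simp: ln_mono)
qed (use ln_tail_nonpos in \<open>auto simp: tail_0 p\<close>)

lemma tail_le_rate:
  assumes "n > 0"
  shows "tail p a n \<le> exp (real n * rate p a)"
proof -
  have "ln (tail p a n) / real n \<le> rate p a"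
    unfolding rate_def using assms ln_tail_nonpos
    by (intro cSUP_upper bdd_aboveI[of _ 0]) (auto simp: divide_nonpos_nonneg)
  then have "ln (tail p a n) \<le> real n * rate p a"
    using assms by (simp add: field_simps)
  then show ?thesis
    using tail_pos[OF p a] by (metis exp_le_cancel_iff exp_ln)
qed

lemma rate_nonpos: "rate p a \<le> 0"
  unfolding rate_def using ln_tail_nonpos by (intro cSUP_least) (auto simp: divide_nonpos_nonneg)

end

section \<open>Large deviations of the normalized mean\<close>

text \<open>A function of the direction only, as positive scaling leaves it unchanged. Where the
  norm vanishes, division by zero gives the value 0.\<close>

definition mean :: "nat \<Rightarrow> real \<Rightarrow> (nat \<Rightarrow> real) \<Rightarrow> real" where
  "mean n p x = (\<Sum>i<n. x i) / (real n * normp n p x)"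

lemma mean_measurable [measurable]: "mean n p \<in> borel_measurable (rhoN n p)"
  unfolding mean_def by measurable

lemma mean_scale:
  assumes "p > 0" "c \<noteq> 0"
  shows "mean n p (scaleN n c x) = sgn c * mean n p x"
proof -
  have "(\<Sum>i<n. scaleN n c x i) = c * (\<Sum>i<n. x i)"
    unfolding sum_distrib_left by (intro sum.cong) auto
  then show ?thesis
    using assms by (simp add: mean_def normp_scale real_sgn_eq)
qed

lemma scaleN_space: "scaleN n c x \<in> space (rhoN n p)"
  by (auto simp: space_PiM)

lemma sum_powr_normalized:
  assumes "n > 0" "p > 0" "normp n p x > 0"
  shows "(\<Sum>i<n. \<bar>x i / normp n p x\<bar> powr p) = real n"
proof -
  have "(\<Sum>i<n. \<bar>x i / normp n p x\<bar> powr p) = (\<Sum>i<n. \<bar>x i\<bar> powr p) / normp n p x powr p"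
    unfolding sum_divide_distrib by (intro sum.cong) (auto simp: powr_divide)
  then show ?thesis
    using assms by (simp add: sum_powr_eq_normp)
qed

text \<open>Young's inequality with second factor 1. The case p = 1, which has no finite conjugate
  exponent, is an equality.\<close>

lemma le_powr_plus:
  fixes t :: real
  assumes "p \<ge> 1" "t \<ge> 0"
  shows "t \<le> t powr p / p + (1 - 1 / p)"
proof (cases "t = 0 \<or> p = 1")
  case False
  then have "t * 1 \<le> t powr p / p + 1 powr (p / (p - 1)) / (p / (p - 1))"
    using assms by (intro Youngs_inequality) (auto simp: diff_divide_distrib)
  then show ?thesis using False assms by (simp add: diff_divide_distrib)
qed (use assms in auto)

text \<open>The power mean inequality: \<open>le_powr_plus\<close> is summed over the normalized
  coordinates, whose p-th powers add up to n.\<close>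

lemma abs_mean_le_1:
  assumes "p \<ge> 1" "n > 0"
  shows "\<bar>mean n p x\<bar> \<le> 1"
proof (cases "normp n p x > 0")
  case True
  let ?s = "\<lambda>i. \<bar>x i / normp n p x\<bar>"
  have "\<bar>mean n p x\<bar> = \<bar>\<Sum>i<n. x i / normp n p x\<bar> / real n"
    by (simp add: mean_def sum_divide_distrib[symmetric] abs_divide)
  also have "\<dots> \<le> (\<Sum>i<n. ?s i) / real n"
    by (intro divide_right_mono sum_abs) auto
  also have "\<dots> \<le> (\<Sum>i<n. ?s i powr p / p + (1 - 1 / p)) / real n"
    using assms by (intro divide_right_mono sum_mono le_powr_plus) auto
  also have "(\<Sum>i<n. ?s i powr p / p + (1 - 1 / p)) = real n / p + real n * (1 - 1 / p)"
    using sum_powr_normalized[OF assms(2) _ True] assms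
    by (simp add: sum.distrib sum_divide_distrib[symmetric])
  also have "\<dots> / real n = 1"
    using assms by (simp add: add_divide_distrib)
  finally show ?thesis .
next
  case False
  then have "normp n p x = 0" using normp_nonneg[of n p x] by linarith
  then show ?thesis by (simp add: mean_def)
qed

text \<open>On the tail set S \<ge> n a \<ge> 0 and R \<le> 1, so that dividing by R keeps the mean
  above a.\<close>

lemma tail_le_mean:
  assumes "p > 0" "n > 0" "a \<ge> 0"
  shows "tail p a n \<le> measure (rhoN n p) {x \<in> space (rhoN n p). a \<le> mean n p x}"
proof -
  interpret prob_space "rhoN n p" using prob_space_rhoN assms by blast
  have "a \<le> mean n p x" if x: "x \<in> tail_set n p a" for x
  proof (cases "normp n p x > 0")
    case True
    have "normp n p x powr p \<le> 1 powr p"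
      using x assms by (simp add: tail_set_def sum_powr_eq_normp)
    then have "normp n p x \<le> 1"
      using assms powr_less_mono2[of p 1 "normp n p x"] by fastforce
    then have "a * (real n * normp n p x) \<le> a * (real n * 1)"
      using assms by (intro mult_left_mono) auto
    also have "\<dots> \<le> (\<Sum>i<n. x i)" using x by (simp add: tail_set_def mult.commute)
    finally show ?thesis
      using True assms by (simp add: mean_def pos_le_divide_eq)
  next
    \<comment> \<open>At the zero vector S = 0 forces a \<le> 0, which agrees with the default value
      0 of the mean.\<close>
    case False
    then have 0: "normp n p x = 0" using normp_nonneg[of n p x] by linarith
    then have "(\<Sum>i<n. \<bar>x i\<bar> powr p) = 0" using sum_powr_eq_normp[of n p x] assms by simp
    then have "(\<Sum>i<n. x i) = 0" by (simp add: sum_nonneg_eq_0_iff)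
    then have "a \<le> 0" using x assms by (auto simp: tail_set_def mult_le_0_iff)
    then show ?thesis by (simp add: mean_def 0)
  qed
  then show ?thesis
    unfolding tail_def by (intro finite_measure_mono) (auto simp: tail_set_def)
qed

text \<open>A partial converse of \<open>tail_le_mean\<close>: since S = n R m, the lower bound on R
  lowers the level only by the factor \<open>exp (-e)\<close>.\<close>

lemma mean_window_le_tail:
  assumes "p > 0" "n > 0" "b \<ge> 0"
  shows "measure (rhoN n p) {x \<in> space (rhoN n p). b \<le> mean n p x \<and> exp (-e) \<le> normp n p x \<and> normp n p x \<le> 1}
    \<le> tail p (exp (-e) * b) n"
proof -
  interpret prob_space "rhoN n p" using prob_space_rhoN assms by blast
  have "x \<in> tail_set n p (exp (-e) * b)"
    if x: "x \<in> space (rhoN n p)" "b \<le> mean n p x" "exp (-e) \<le> normp n p x" "normp n p x \<le> 1" for x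
  proof -
    have pos: "normp n p x > 0" using x(3) exp_gt_zero[of "-e"] by linarith
    have "real n * (exp (-e) * b) \<le> real n * (normp n p x * b)"
      using x assms by (intro mult_left_mono mult_right_mono) auto
    also have "\<dots> \<le> (\<Sum>i<n. x i)"
      using x(2) pos assms by (simp add: mean_def pos_le_divide_eq mult_ac)
    finally have "real n * (exp (-e) * b) \<le> (\<Sum>i<n. x i)" .
    moreover have "normp n p x powr p \<le> 1 powr p"
      using x(4) assms by (intro powr_mono2) auto
    ultimately show ?thesis
      using x(1) assms by (simp add: tail_set_def sum_powr_eq_normp mult_le_cancel_left1)
  qed
  then show ?thesis
    unfolding tail_def by (intro finite_measure_mono) auto
qed

text \<open>The reflection \<open>scaleN n (-1)\<close> has density 1, so m and -m have the same
  law.\<close>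

lemma abs_mean_measure_le:
  assumes "p > 0" "n > 0"
  shows "measure (rhoN n p) {x \<in> space (rhoN n p). b \<le> \<bar>mean n p x\<bar>} \<le>
    2 * measure (rhoN n p) {x \<in> space (rhoN n p). b \<le> mean n p x}"
proof -
  interpret prob_space "rhoN n p" using prob_space_rhoN assms by blast
  let ?A = "{x \<in> space (rhoN n p). b \<le> mean n p x}"
  let ?A' = "{x \<in> space (rhoN n p). b \<le> - mean n p x}"
  have "emeasure (rhoN n p) ?A' = (\<integral>\<^sup>+x. indicator {b..} (- mean n p x) \<partial>rhoN n p)"
    by (subst nn_integral_indicator[symmetric])
       (auto intro!: nn_integral_cong simp: indicator_def simp del: nn_integral_indicator)
  also have "\<dots> = (\<integral>\<^sup>+x. (\<lambda>x. indicator {b..} (mean n p x)) (scaleN n (-1) x) \<partial>rhoN n p)"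
    using mean_scale[OF assms(1), of "-1" n] by simp
  also have "\<dots> = (\<integral>\<^sup>+x. indicator {b..} (mean n p x) \<partial>rhoN n p)"
    using assms by (subst nn_integral_scale_rhoN) auto
  also have "\<dots> = emeasure (rhoN n p) ?A"
    by (subst nn_integral_indicator[symmetric])
       (auto intro!: nn_integral_cong simp: indicator_def simp del: nn_integral_indicator)
  finally have sym: "prob ?A' = prob ?A" by (simp add: measure_def)
  have "prob {x \<in> space (rhoN n p). b \<le> \<bar>mean n p x\<bar>} \<le> prob (?A \<union> ?A')"
    by (intro finite_measure_mono) auto
  also have "\<dots> \<le> prob ?A + prob ?A'" by (intro measure_Un_le) auto
  finally show ?thesis by (simp add: sym)
qed

text \<open>The set where m \<ge> b is a cone, so its probability passes first to the norm window,
  then to a tail set, then to the rate. The two signs of m double the constant.\<close>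

lemma abs_mean_measure_le_rate:
  assumes p: "p > 0"
  obtains K where "K > 0" "\<And>n e b. n > 0 \<Longrightarrow> e > 0 \<Longrightarrow> 0 \<le> b \<Longrightarrow> b \<le> 1 \<Longrightarrow>
    measure (rhoN n p) {x \<in> space (rhoN n p). b \<le> \<bar>mean n p x\<bar>} \<le>
      K / e * exp (real n * e) * exp (real n * rate p (exp (-e) * b))"
proof (rule cone_measure_le_window[OF p])
  fix K assume K: "K > 0" "\<And>n e C. n > 0 \<Longrightarrow> e > 0 \<Longrightarrow> C \<in> sets (rhoN n p) \<Longrightarrow>
    (\<And>c x. c > 0 \<Longrightarrow> x \<in> space (rhoN n p) \<Longrightarrow> scaleN n c x \<in> C \<longleftrightarrow> x \<in> C) \<Longrightarrow>
    measure (rhoN n p) C \<le> K / e * exp (real n * e) *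
      measure (rhoN n p) (C \<inter> {x \<in> space (rhoN n p). exp (-e) \<le> normp n p x \<and> normp n p x \<le> 1})"
  show thesis
  proof (rule that)
    fix n :: nat and e b :: real
    assume n: "n > 0" and e: "e > 0" and b: "0 \<le> b" "b \<le> 1"
    interpret prob_space "rhoN n p" using prob_space_rhoN p by blast
    let ?A = "{x \<in> space (rhoN n p). b \<le> mean n p x}"
    \<comment> \<open>The factor \<open>exp (-e)\<close> brings the level strictly below 1 even for
      b = 1, as the bound by the rate demands.\<close>
    have eb: "0 \<le> exp (-e) * b" "exp (-e) * b < 1"
    proof -
      have "exp (-e) * b \<le> exp (-e) * 1" using b by (intro mult_left_mono) auto
      also have "\<dots> < 1" using e by simp
      finally show "exp (-e) * b < 1" .
    qed (use b in auto)
    show "measure (rhoN n p) {x \<in> space (rhoN n p). b \<le> \<bar>mean n p x\<bar>} \<le>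
      (2 * K) / e * exp (real n * e) * exp (real n * rate p (exp (-e) * b))"
    proof -
      have "prob ?A \<le> K / e * exp (real n * e) *
          prob (?A \<inter> {x \<in> space (rhoN n p). exp (-e) \<le> normp n p x \<and> normp n p x \<le> 1})"
        using p scaleN_space by (intro K n e) (auto simp: mean_scale)
      also have "?A \<inter> {x \<in> space (rhoN n p). exp (-e) \<le> normp n p x \<and> normp n p x \<le> 1} =
          {x \<in> space (rhoN n p). b \<le> mean n p x \<and> exp (-e) \<le> normp n p x \<and> normp n p x \<le> 1}"
        by auto
      also have "K / e * exp (real n * e) * prob \<dots> \<le> K / e * exp (real n * e) * exp (real n * rate p (exp (-e) * b))"
        using mean_window_le_tail[OF p n b(1), of e] tail_le_rate[OF p eb n] K(1) e
        by (intro mult_left_mono) auto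
      finally show ?thesis
        using abs_mean_measure_le[OF p n, of b] by simp
    qed
  qed (use K in auto)
qed

section \<open>Varadhan's lemma for the normalized mean\<close>

text \<open>The level 1 is left out: for p > 1 and positive n its tail set is null, and
  \<open>rate p 1\<close> would only reflect the default value of \<open>ln\<close> at 0.\<close>

definition varadhan :: "real \<Rightarrow> (real \<Rightarrow> real) \<Rightarrow> real" where
  "varadhan p f = (SUP a\<in>{0..<1}. f a + rate p a)"

definition expmean :: "nat \<Rightarrow> real \<Rightarrow> (real \<Rightarrow> real) \<Rightarrow> real" where
  "expmean n p f = (\<integral>x. exp (real n * f \<bar>mean n p x\<bar>) \<partial>rhoN n p)"

context
  fixes p :: real and f :: "real \<Rightarrow> real"
  assumes p: "p \<ge> 1" and mono: "mono_on {0..1} f" and f_meas [measurable]: "f \<in> borel_measurable borel"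
begin

private lemma p0: "p > 0" using p by simp

lemma bdd_above_varadhan: "bdd_above ((\<lambda>a. f a + rate p a) ` {0..<1})"
proof (rule bdd_aboveI2)
  fix a :: real assume "a \<in> {0..<1}"
  then show "f a + rate p a \<le> f 1"
    using rate_nonpos[OF p0, of a] mono_onD[OF mono, of a 1] by auto
qed

lemma le_varadhan: "0 \<le> a \<Longrightarrow> a < 1 \<Longrightarrow> f a + rate p a \<le> varadhan p f"
  unfolding varadhan_def by (intro cSUP_upper bdd_above_varadhan) auto

lemma integrable_expmean:
  assumes n: "n > 0"
  shows "integrable (rhoN n p) (\<lambda>x. exp (real n * f \<bar>mean n p x\<bar>))"
proof -
  interpret prob_space "rhoN n p" using prob_space_rhoN p0 by blast
  show ?thesis
  proof (rule integrable_const_bound[where B = "exp (real n * f 1)"])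
    show "AE x in rhoN n p. norm (exp (real n * f \<bar>mean n p x\<bar>)) \<le> exp (real n * f 1)"
      using abs_mean_le_1[OF p n] by (auto intro!: mult_left_mono mono_onD[OF mono])
  qed measurable
qed

text \<open>Markov's inequality: where m \<ge> a, monotonicity of f bounds the integrand below by
  its value at a.\<close>

lemma expmean_ge_tail:
  assumes n: "n > 0" and a: "0 \<le> a" "a < 1"
  shows "exp (real n * f a) * tail p a n \<le> expmean n p f"
proof -
  interpret prob_space "rhoN n p" using prob_space_rhoN p0 by blast
  let ?A = "{x \<in> space (rhoN n p). a \<le> mean n p x}"
  have "exp (real n * f a) * tail p a n \<le> exp (real n * f a) * prob ?A"
    using tail_le_mean[OF p0 n a(1)] by (intro mult_left_mono) auto
  also have "\<dots> = (\<integral>x. exp (real n * f a) * indicator ?A x \<partial>rhoN n p)"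
    by simp
  also have "\<dots> \<le> expmean n p f"
    unfolding expmean_def
  proof (intro integral_mono integrable_expmean n)
    fix x
    show "exp (real n * f a) * indicator ?A x \<le> exp (real n * f \<bar>mean n p x\<bar>)"
      using a abs_mean_le_1[OF p n, of x]
      by (auto simp: indicator_def intro!: mult_left_mono mono_onD[OF mono])
  qed (auto intro!: integrable_real_mult_indicator integrable_real_indicator simp: less_top[symmetric])
  finally show ?thesis .
qed

lemma expmean_pos: "n > 0 \<Longrightarrow> expmean n p f > 0"
  using expmean_ge_tail[of n 0] tail_pos[OF p0, of 0 n] by (auto intro: less_le_trans[rotated])

text \<open>The range of |m| is cut into N cells of width e. On each cell f is bounded by its value
  at the right end and the probability by the deviation bound at the left end. There are finitely
  many cells, so their number goes into K.\<close>

lemma expmean_le_varadhan: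
  assumes cont: "continuous_on {0..1} f" and d: "d > 0"
  obtains K where "K > 0" "\<And>n. n > 0 \<Longrightarrow> expmean n p f \<le> K * exp (real n * (varadhan p f + d))"
proof -
  obtain C where C: "C > 0" "\<And>n e b. n > 0 \<Longrightarrow> e > 0 \<Longrightarrow> 0 \<le> b \<Longrightarrow> b \<le> 1 \<Longrightarrow>
    measure (rhoN n p) {x \<in> space (rhoN n p). b \<le> \<bar>mean n p x\<bar>} \<le>
      C / e * exp (real n * e) * exp (real n * rate p (exp (-e) * b))"
    using abs_mean_measure_le_rate[OF p0] by blast
  have "uniformly_continuous_on {0..1} f"
    using cont by (intro compact_uniformly_continuous) auto
  then obtain h where h: "h > 0"
      "\<And>u v. u \<in> {0..1} \<Longrightarrow> v \<in> {0..1} \<Longrightarrow> dist v u < h \<Longrightarrow> dist (f v) (f u) < d / 2"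
    unfolding uniformly_continuous_on_def using d by (metis half_gt_zero)
  obtain N :: nat where N: "real N > max (2 / h) (2 / d)"
    using reals_Archimedean2 by blast
  then have N0: "N > 0" using h d by (auto intro: gr0I simp: divide_less_0_iff not_less)
  \<comment> \<open>One e serves as cell width and as norm window. Below 2 e < h controls the
    oscillation of f by d/2, and e < d/2 absorbs the cost of the window.\<close>
  define e where "e = 1 / real N"
  have e: "e > 0" "2 * e < h" "e < d / 2"
    using N N0 h d by (auto simp: e_def field_simps)
  let ?b = "\<lambda>k. real k * e"
  have bk: "0 \<le> ?b k" "?b k + e \<le> 1" if "k < N" for k
    using that N0 by (auto simp: e_def field_simps)
  let ?K = "real N * (C / e)"
  show thesis
  proof (rule that)
    show "?K > 0" using C N0 e by simp
    fix n :: nat assume n: "n > 0"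
    interpret prob_space "rhoN n p" using prob_space_rhoN p0 by blast
    let ?A = "\<lambda>k. {x \<in> space (rhoN n p). ?b k \<le> \<bar>mean n p x\<bar>}"
    have int: "integrable (rhoN n p) (\<lambda>x. c * indicator (?A k) x)" for c :: real and k
      by (auto intro!: integrable_real_mult_indicator integrable_real_indicator simp: less_top[symmetric])
    have "expmean n p f \<le> (\<integral>x. (\<Sum>k<N. exp (real n * f (?b k + e)) * indicator (?A k) x) \<partial>rhoN n p)"
      unfolding expmean_def
    proof (intro integral_mono integrable_expmean n)
      fix x assume x: "x \<in> space (rhoN n p)"
      let ?t = "\<bar>mean n p x\<bar>"
      have t: "0 \<le> ?t" "?t \<le> 1" using abs_mean_le_1[OF p n] by auto
      \<comment> \<open>The minimum puts the endpoint |m| = 1, whose floor would be N, into the last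
        cell.\<close>
      define k where "k = min (nat \<lfloor>?t * real N\<rfloor>) (N - 1)"
      have k: "k < N" using N0 by (auto simp: k_def)
      have "real k \<le> ?t * real N"
        using t by (auto simp: k_def min_def) linarith+
      then have lo: "?b k \<le> ?t" using N0 by (simp add: e_def field_simps)
      have "?t * real N \<le> real k + 1"
        using t N0 mult_right_mono[of ?t 1 "real N"] by (auto simp: k_def min_def of_nat_diff)
      then have hi: "?t \<le> ?b k + e" using N0 by (simp add: e_def field_simps)
      have "exp (real n * f ?t) \<le> exp (real n * f (?b k + e)) * indicator (?A k) x"
        using x lo hi t bk[OF k] by (auto intro!: mult_left_mono mono_onD[OF mono])
      also have "\<dots> \<le> (\<Sum>k<N. exp (real n * f (?b k + e)) * indicator (?A k) x)"
        using k by (intro member_le_sum) auto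
      finally show "exp (real n * f ?t) \<le> (\<Sum>k<N. exp (real n * f (?b k + e)) * indicator (?A k) x)" .
    qed (intro Bochner_Integration.integrable_sum int)
    also have "\<dots> = (\<Sum>k<N. exp (real n * f (?b k + e)) * prob (?A k))"
      by (subst Bochner_Integration.integral_sum[OF int]) simp
    also have "\<dots> \<le> (\<Sum>k<N. C / e * exp (real n * (varadhan p f + d)))"
    proof (intro sum_mono)
      fix k assume "k \<in> {..<N}"
      then have k: "k < N" by simp
      \<comment> \<open>The rate is evaluated at this lowered level. It lies between
        \<open>?b k - e\<close> and \<open>?b k\<close>, hence within 2 e of the right end of the
        cell.\<close>
      let ?a = "exp (-e) * ?b k"
      have ea: "exp (-e) \<le> 1" "1 - e \<le> exp (-e)"
        using e exp_ge_add_one_self[of "-e"] by auto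
      have "?a \<le> 1 * ?b k" using ea bk[OF k] by (intro mult_right_mono) auto
      then have a: "0 \<le> ?a" "?a < 1" "?a \<le> ?b k" using bk[OF k] e by auto
      have "(1 - e) * ?b k \<le> ?a" using ea bk[OF k] by (intro mult_right_mono) auto
      moreover have "e * ?b k \<le> e * 1" using bk[OF k] e by (intro mult_left_mono) auto
      ultimately have "?b k - e \<le> ?a" by (simp add: algebra_simps)
      then have "dist (?b k + e) ?a < h" using e a(3) by (auto simp: dist_real_def)
      then have "dist (f (?b k + e)) (f ?a) < d / 2"
        using a bk[OF k] e by (intro h) auto
      then have fk: "f (?b k + e) \<le> f ?a + d / 2"
        unfolding dist_real_def by linarith
      have "exp (real n * f (?b k + e)) * prob (?A k) \<le>
          exp (real n * f (?b k + e)) * (C / e * exp (real n * e) * exp (real n * rate p ?a))"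
        using bk[OF k] e by (intro mult_left_mono C(2) n) auto
      also have "\<dots> = C / e * exp (real n * (f (?b k + e) + e + rate p ?a))"
        by (simp add: distrib_left exp_add)
      also have "\<dots> \<le> C / e * exp (real n * (varadhan p f + d))"
        using fk e le_varadhan[OF a(1,2)] C(1)
        by (intro mult_left_mono iffD2[OF exp_le_cancel_iff]) auto
      finally show "exp (real n * f (?b k + e)) * prob (?A k) \<le> C / e * exp (real n * (varadhan p f + d))" .
    qed
    finally show "expmean n p f \<le> ?K * exp (real n * (varadhan p f + d))"
      by simp
  qed
qed

text \<open>Below, each level a contributes f a + \<open>rate p a\<close> through the limit of the
  tails; above, the constant K disappears after division by n.\<close>

lemma varadhan_limit:
  assumes cont: "continuous_on {0..1} f"
  shows "(\<lambda>n. ln (expmean n p f) / real n) \<longlonglongrightarrow> varadhan p f"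
proof (rule order_tendstoI)
  fix y assume "y < varadhan p f"
  then obtain a where a: "0 \<le> a" "a < 1" "y < f a + rate p a"
    unfolding varadhan_def using less_cSUP_iff[OF _ bdd_above_varadhan] by auto
  have "(\<lambda>n. f a + ln (tail p a n) / real n) \<longlonglongrightarrow> f a + rate p a"
    by (intro tendsto_intros tail_limit p0 a)
  then have "\<forall>\<^sub>F n in sequentially. y < f a + ln (tail p a n) / real n"
    using a by (intro order_tendstoD)
  then show "\<forall>\<^sub>F n in sequentially. y < ln (expmean n p f) / real n"
    using eventually_gt_at_top[of 0]
  proof eventually_elim
    case (elim n)
    have "ln (exp (real n * f a) * tail p a n) \<le> ln (expmean n p f)"
      using expmean_ge_tail[OF elim(2) a(1,2)] tail_pos[OF p0 a(1,2), of n] by (intro ln_mono) auto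
    then have "real n * f a + ln (tail p a n) \<le> ln (expmean n p f)"
      using tail_pos[OF p0 a(1,2), of n] by (simp add: ln_mult)
    then have "(real n * f a + ln (tail p a n)) / real n \<le> ln (expmean n p f) / real n"
      by (intro divide_right_mono) auto
    then show ?case using elim by (simp add: add_divide_distrib)
  qed
next
  fix y assume y: "varadhan p f < y"
  define d where "d = (y - varadhan p f) / 2"
  have d: "d > 0" using y by (simp add: d_def)
  obtain K where K: "K > 0" "\<And>n. n > 0 \<Longrightarrow> expmean n p f \<le> K * exp (real n * (varadhan p f + d))"
    using expmean_le_varadhan[OF cont d] by blast
  have "(\<lambda>n. ln K / real n + (varadhan p f + d)) \<longlonglongrightarrow> 0 + (varadhan p f + d)"
    by (intro tendsto_intros lim_const_over_n)
  moreover have "0 + (varadhan p f + d) < y" using y by (simp add: d_def field_simps)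
  ultimately have "\<forall>\<^sub>F n in sequentially. ln K / real n + (varadhan p f + d) < y"
    by (rule order_tendstoD)
  then show "\<forall>\<^sub>F n in sequentially. ln (expmean n p f) / real n < y"
    using eventually_gt_at_top[of 0]
  proof eventually_elim
    case (elim n)
    have "ln (expmean n p f) \<le> ln (K * exp (real n * (varadhan p f + d)))"
      using K elim expmean_pos[of n] by (intro ln_mono) auto
    also have "\<dots> = ln K + real n * (varadhan p f + d)"
      using K by (simp add: ln_mult)
    finally have "ln (expmean n p f) / real n \<le> (ln K + real n * (varadhan p f + d)) / real n"
      by (intro divide_right_mono) auto
    then show ?case using elim by (simp add: add_divide_distrib)
  qed
qed

end

section \<open>The free energy\<close>

lemma Ham_eq:
  "Ham n \<sigma> = ((\<Sum>i<n. \<sigma> i)\<^sup>2 - (\<Sum>i<n. (\<sigma> i)\<^sup>2)) / (2 * real n)"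
proof -
  have "(\<Sum>i<n. \<sigma> i)\<^sup>2 = (\<Sum>i<n. (\<sigma> i)\<^sup>2) + 2 * (\<Sum>j<n. \<Sum>i<j. \<sigma> i * \<sigma> j)"
    by (induction n) (auto simp: power2_sum algebra_simps sum_distrib_left[symmetric] sum_distrib_right[symmetric])
  then show ?thesis by (simp add: Ham_def)
qed

text \<open>For a normalized coordinate s, write s^2 = |s|^p |s|^(2-p). The p-th powers sum to n, so
  |s| \<le> n^(1/p) bounds the second factor.\<close>

lemma sum_squares_normalized_le:
  assumes "n > 0" "p > 0" "p \<le> 2"
  shows "(\<Sum>i<n. (x i / normp n p x)\<^sup>2) \<le> real n powr (2 / p)"
proof (cases "normp n p x > 0")
  case True
  let ?s = "\<lambda>i. \<bar>x i / normp n p x\<bar>"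
  have sum: "(\<Sum>i<n. ?s i powr p) = real n"
    by (rule sum_powr_normalized) (use assms True in auto)
  have "(x i / normp n p x)\<^sup>2 \<le> ?s i powr p * real n powr ((2 - p) / p)" if "i < n" for i
  proof -
    have "?s i powr p \<le> real n"
      unfolding sum[symmetric] using that by (intro member_le_sum) auto
    then have "(?s i powr p) powr ((2 - p) / p) \<le> real n powr ((2 - p) / p)"
      using assms by (intro powr_mono2) auto
    then have "?s i powr (2 - p) \<le> real n powr ((2 - p) / p)"
      using assms by (simp add: powr_powr)
    then have "?s i powr p * ?s i powr (2 - p) \<le> ?s i powr p * real n powr ((2 - p) / p)"
      by (intro mult_left_mono) auto
    moreover have "?s i powr p * ?s i powr (2 - p) = (x i / normp n p x)\<^sup>2"
      by (cases "x i = 0") (use True in \<open>auto simp: powr_add[symmetric] power_divide\<close>)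
    ultimately show ?thesis by simp
  qed
  then have "(\<Sum>i<n. (x i / normp n p x)\<^sup>2) \<le> (\<Sum>i<n. ?s i powr p * real n powr ((2 - p) / p))"
    by (intro sum_mono) auto
  also have "\<dots> = real n powr 1 * real n powr ((2 - p) / p)"
    unfolding sum_distrib_right[symmetric] sum using assms by simp
  also have "\<dots> = real n powr (1 + (2 - p) / p)"
    by (simp only: powr_add)
  also have "1 + (2 - p) / p = 2 / p"
    using assms by (simp add: diff_divide_distrib)
  finally show ?thesis .
next
  case False
  then have "normp n p x = 0" using normp_nonneg[of n p x] by linarith
  then show ?thesis by simp
qed

text \<open>The Hamiltonian differs from n m^2 / 2 by the diagonal sum of squares over 2n, which
  lies between 0 and n^(2/p) / (2n).\<close>

lemma Ham_normalized_bounds: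
  assumes "n > 0" "p > 0" "p \<le> 2"
  shows "Ham n (\<lambda>i. x i / normp n p x) \<le> real n * (\<bar>mean n p x\<bar>\<^sup>2 / 2)"
    and "real n * (\<bar>mean n p x\<bar>\<^sup>2 / 2) - real n powr (2 / p) / (2 * real n) \<le> Ham n (\<lambda>i. x i / normp n p x)"
proof -
  let ?Q = "\<Sum>i<n. (x i / normp n p x)\<^sup>2"
  have "(\<Sum>i<n. x i / normp n p x) = real n * mean n p x"
    using assms by (simp add: mean_def sum_divide_distrib[symmetric])
  then have H: "Ham n (\<lambda>i. x i / normp n p x) = real n * (\<bar>mean n p x\<bar>\<^sup>2 / 2) - ?Q / (2 * real n)"
    using assms by (simp add: Ham_eq diff_divide_distrib power2_eq_square)
  have "?Q \<ge> 0" by (intro sum_nonneg) auto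
  then show "Ham n (\<lambda>i. x i / normp n p x) \<le> real n * (\<bar>mean n p x\<bar>\<^sup>2 / 2)"
    unfolding H by simp
  show "real n * (\<bar>mean n p x\<bar>\<^sup>2 / 2) - real n powr (2 / p) / (2 * real n) \<le> Ham n (\<lambda>i. x i / normp n p x)"
    unfolding H using sum_squares_normalized_le[OF assms, of x] by (simp add: divide_right_mono)
qed

lemma Zpart_bounds:
  assumes n: "n > 0" and p: "1 \<le> p" "p \<le> 2" and b: "\<beta> \<ge> 0"
  defines "E \<equiv> expmean n p (\<lambda>a. \<beta> * a\<^sup>2 / 2)"
  shows "Zpart n p \<beta> \<le> E"
    and "exp (- \<beta> * (real n powr (2 / p) / (2 * real n))) * E \<le> Zpart n p \<beta>"
proof -
  interpret prob_space "rhoN n p" using prob_space_rhoN p by auto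
  let ?f = "\<lambda>a::real. \<beta> * a\<^sup>2 / 2"
  let ?q = "real n powr (2 / p) / (2 * real n)"
  have mono: "mono_on {0..1} ?f"
    using b by (auto intro!: mono_onI mult_left_mono power_mono)
  have int: "integrable (rhoN n p) (\<lambda>x. exp (real n * ?f \<bar>mean n p x\<bar>))"
    by (rule integrable_expmean) (use p n mono in auto)
  have up: "exp (\<beta> * Ham n (\<lambda>i. x i / normp n p x)) \<le> exp (real n * ?f \<bar>mean n p x\<bar>)" for x
    using mult_left_mono[OF Ham_normalized_bounds(1)[of n p x] b] n p by (simp add: mult_ac)
  have lo: "exp (- \<beta> * ?q) * exp (real n * ?f \<bar>mean n p x\<bar>) \<le> exp (\<beta> * Ham n (\<lambda>i. x i / normp n p x))" for x
    using mult_left_mono[OF Ham_normalized_bounds(2)[of n p x] b] n p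
    by (simp add: mult_ac right_diff_distrib flip: exp_add)
  have int_H: "integrable (rhoN n p) (\<lambda>x. exp (\<beta> * Ham n (\<lambda>i. x i / normp n p x)))"
  proof (rule Bochner_Integration.integrable_bound[OF int])
    show "(\<lambda>x. exp (\<beta> * Ham n (\<lambda>i. x i / normp n p x))) \<in> borel_measurable (rhoN n p)"
      unfolding Ham_eq by measurable
  qed (use up in auto)
  show "Zpart n p \<beta> \<le> E"
    unfolding Zpart_def E_def expmean_def by (intro integral_mono int int_H up)
  have "exp (- \<beta> * ?q) * E = (\<integral>x. exp (- \<beta> * ?q) * exp (real n * ?f \<bar>mean n p x\<bar>) \<partial>rhoN n p)"
    unfolding E_def expmean_def by simp
  also have "\<dots> \<le> Zpart n p \<beta>"
    unfolding Zpart_def by (intro integral_mono integrable_mult_right int int_H lo)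
  finally show "exp (- \<beta> * ?q) * E \<le> Zpart n p \<beta>" .
qed

text \<open>The diagonal term changes the free energy by at most \<beta>/2 times n^(2/p - 2), and
  this tends to 0 because p > 1.\<close>

lemma free_energy_limit:
  assumes p: "1 < p" "p \<le> 2" and b: "\<beta> \<ge> 0"
  shows "(\<lambda>n. ln (Zpart n p \<beta>) / real n) \<longlonglongrightarrow> varadhan p (\<lambda>a. \<beta> * a\<^sup>2 / 2)"
proof -
  let ?f = "\<lambda>a::real. \<beta> * a\<^sup>2 / 2"
  let ?E = "\<lambda>n. expmean n p ?f"
  have mono: "mono_on {0..1} ?f"
    using b by (auto intro!: mono_onI mult_left_mono power_mono)
  have E: "(\<lambda>n. ln (?E n) / real n) \<longlonglongrightarrow> varadhan p ?f"
    using p mono by (intro varadhan_limit) (auto intro!: continuous_intros)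
  have pos: "?E n > 0" if "n > 0" for n
    using p mono that by (intro expmean_pos) auto
  have "((\<lambda>x. x powr (2 / p - 2)) \<longlongrightarrow> 0) at_top"
    using p by (intro tendsto_neg_powr filterlim_ident) (auto simp: field_simps)
  then have "(\<lambda>n. real n powr (2 / p - 2)) \<longlonglongrightarrow> 0"
    by (rule filterlim_compose) (rule filterlim_real_sequentially)
  then have lower_lim: "(\<lambda>n. ln (?E n) / real n - \<beta> / 2 * real n powr (2 / p - 2)) \<longlonglongrightarrow> varadhan p ?f - \<beta> / 2 * 0"
    by (intro tendsto_intros E)
  show ?thesis
  proof (rule tendsto_sandwich)
    show "\<forall>\<^sub>F n in sequentially. ln (?E n) / real n - \<beta> / 2 * real n powr (2 / p - 2) \<le> ln (Zpart n p \<beta>) / real n"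
      using eventually_gt_at_top[of 0]
    proof eventually_elim
      case (elim n)
      let ?q = "real n powr (2 / p) / (2 * real n)"
      note Z = Zpart_bounds(2)[OF elim less_imp_le[OF p(1)] p(2) b]
      have "ln (exp (- \<beta> * ?q) * ?E n) \<le> ln (Zpart n p \<beta>)"
        using pos[OF elim] Z by (intro ln_mono) auto
      then have "(- \<beta> * ?q + ln (?E n)) / real n \<le> ln (Zpart n p \<beta>) / real n"
        using pos[OF elim] by (intro divide_right_mono) (auto simp: ln_mult)
      moreover have "(- \<beta> * ?q + ln (?E n)) / real n = ln (?E n) / real n - \<beta> / 2 * real n powr (2 / p - 2)"
        using elim by (simp add: powr_diff power2_eq_square diff_divide_distrib)
      ultimately show ?case by (simp only:)
    qed
    show "\<forall>\<^sub>F n in sequentially. ln (Zpart n p \<beta>) / real n \<le> ln (?E n) / real n"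
      using eventually_gt_at_top[of 0]
    proof eventually_elim
      case (elim n)
      note Z = Zpart_bounds[OF elim less_imp_le[OF p(1)] p(2) b]
      have "0 < exp (- \<beta> * (real n powr (2 / p) / (2 * real n))) * ?E n"
        using pos[OF elim] by simp
      then show ?case using Z by (intro divide_right_mono ln_mono) auto
    qed
  qed (use E lower_lim in auto)
qed

lemma Ep_eq_varadhan:
  assumes "1 < p" "p \<le> 2" "\<beta> \<ge> 0"
  shows "Ep p \<beta> = varadhan p (\<lambda>a. \<beta> * a\<^sup>2 / 2)"
  unfolding Ep_def by (intro limI free_energy_limit assms)

section \<open>Duality\<close>

lemma young_conjugate_le:
  fixes u z r :: real
  assumes "r > 1" "u \<ge> 0" "z \<ge> 0"
  shows "u * z - z powr r / r \<le> u powr (r / (r - 1)) / (r / (r - 1))"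
proof -
  have "z * u \<le> z powr r / r + u powr (r / (r - 1)) / (r / (r - 1))"
    using assms by (intro Youngs_inequality) (auto simp: diff_divide_distrib)
  then show ?thesis by (simp add: mult.commute)
qed

text \<open>The chosen z solves u = z^(r-1), the critical point equation of u z - z^r / r.\<close>

lemma young_conjugate_eq:
  fixes u r :: real
  assumes "r > 1" "u \<ge> 0"
  defines "z \<equiv> u powr (1 / (r - 1))"
  shows "u * z - z powr r / r = u powr (r / (r - 1)) / (r / (r - 1))"
proof -
  have "u * z = u powr (1 + 1 / (r - 1))"
    using assms by (cases "u = 0") (auto simp: powr_add)
  also have "1 + 1 / (r - 1) = r / (r - 1)"
    using assms by (simp add: field_simps)
  finally have "u * z = u powr (r / (r - 1))" .
  moreover have "z powr r = u powr (r / (r - 1))"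
    by (simp add: z_def powr_powr)
  ultimately show ?thesis
    using assms by (simp add: diff_divide_distrib right_diff_distrib)
qed

text \<open>\<open>conj_power p y\<close> is the Legendre dual both of \<open>z \<mapsto> z\<^sup>p/p\<close> at \<open>\<surd>y a\<close> and of
  \<open>x \<mapsto> (2-p)/(2p) x\<^bsup>p/(2-p)\<^esup>\<close> at \<open>y a\<^sup>2/2\<close>; this is why both suprema agree.\<close>

definition conj_power :: "real \<Rightarrow> real \<Rightarrow> real \<Rightarrow> real" where
  "conj_power p y a = (sqrt y * a) powr (p / (p - 1)) / (p / (p - 1))"

lemma conj_power_mono: "p > 1 \<Longrightarrow> y \<ge> 0 \<Longrightarrow> mono_on {0..1} (conj_power p y)"
  unfolding conj_power_def
  by (intro mono_onI divide_right_mono powr_mono2 mult_left_mono) auto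

lemma conj_power_measurable [measurable]: "conj_power p y \<in> borel_measurable borel"
  unfolding conj_power_def by measurable

lemma conj_power_continuous: "p > 1 \<Longrightarrow> y \<ge> 0 \<Longrightarrow> continuous_on {0..1} (conj_power p y)"
  unfolding conj_power_def
  by (intro continuous_on_divide continuous_on_powr' continuous_intros) auto

text \<open>With r = p/(2-p) > 1 the left-hand side is half of Young's expression u x - x^r / r at u
  = y a^2. The conjugate exponent of r is half of p/(p-1), which is matched by y a^2 being the
  square of \<open>sqrt y * a\<close>.\<close>

lemma quadratic_conjugate_le:
  assumes p: "1 < p" "p < 2" and "x \<ge> 0" "y \<ge> 0" "a \<ge> 0"
  shows "x * y * a\<^sup>2 / 2 - (2 - p) / (2 * p) * x powr (p / (2 - p)) \<le> conj_power p y a"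
    and "x = (y * a\<^sup>2) powr ((2 - p) / (2 * p - 2)) \<Longrightarrow>
      x * y * a\<^sup>2 / 2 - (2 - p) / (2 * p) * x powr (p / (2 - p)) = conj_power p y a"
proof -
  define r where "r = p / (2 - p)"
  have r: "r > 1" using p by (simp add: r_def)
  have r1: "r - 1 = (2 * p - 2) / (2 - p)" using p by (simp add: r_def field_simps)
  have r': "r / (r - 1) * 2 = p / (p - 1)"
    unfolding r1 using p by (simp add: r_def divide_simps)
  have eq: "x * y * a\<^sup>2 / 2 - (2 - p) / (2 * p) * x powr (p / (2 - p)) = (y * a\<^sup>2 * x - x powr r / r) / 2"
    using p by (simp add: r_def field_simps)
  have pw: "(y * a\<^sup>2) powr (r / (r - 1)) = (sqrt y * a) powr (p / (p - 1))"
  proof -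
    have "y * a\<^sup>2 = (sqrt y * a) powr 2"
      using assms by (simp add: power_mult_distrib)
    then show ?thesis by (simp only: powr_powr mult.commute[of 2] r')
  qed
  have c: "(y * a\<^sup>2) powr (r / (r - 1)) / (r / (r - 1)) / 2 = conj_power p y a"
    by (simp only: conj_power_def pw divide_divide_eq_left r')
  show "x * y * a\<^sup>2 / 2 - (2 - p) / (2 * p) * x powr (p / (2 - p)) \<le> conj_power p y a"
    unfolding eq c[symmetric]
    using young_conjugate_le[OF r, of "y * a\<^sup>2" x] assms by (intro divide_right_mono) auto
  assume "x = (y * a\<^sup>2) powr ((2 - p) / (2 * p - 2))"
  then have "x = (y * a\<^sup>2) powr (1 / (r - 1))" by (simp add: r1)
  then show "x * y * a\<^sup>2 / 2 - (2 - p) / (2 * p) * x powr (p / (2 - p)) = conj_power p y a"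
    unfolding eq c[symmetric] using young_conjugate_eq[OF r, of "y * a\<^sup>2"] assms by simp
qed

text \<open>Since \<open>Ep\<close> is itself a supremum over a, the suprema over x and a are
  exchanged: Young's inequality bounds every pair, and its equality case supplies an x for each a.
  Boundedness is recorded because real suprema need it.\<close>

lemma Sup_free_energy:
  assumes p: "1 < p" "p < 2" and y: "y \<ge> 0"
  shows "(SUP x\<in>{0..}. Ep p (x * y) - (2 - p) / (2 * p) * x powr (p / (2 - p))) = varadhan p (conj_power p y)"
    and "bdd_above ((\<lambda>x. Ep p (x * y) - (2 - p) / (2 * p) * x powr (p / (2 - p))) ` {0..})"
proof -
  let ?c = "\<lambda>x. (2 - p) / (2 * p) * x powr (p / (2 - p))"
  let ?f = "\<lambda>x a::real. x * y * a\<^sup>2 / 2"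
  have p': "1 \<le> p" using p by simp
  have mono: "mono_on {0..1} (?f x)" if "x \<ge> 0" for x
    using that y by (auto intro!: mono_onI mult_left_mono power_mono)
  have Ep: "Ep p (x * y) = varadhan p (?f x)" if "x \<ge> 0" for x
    using that p y by (intro Ep_eq_varadhan) auto
  have le: "Ep p (x * y) - ?c x \<le> varadhan p (conj_power p y)" if x: "x \<in> {0..}" for x
  proof -
    have "varadhan p (?f x) \<le> varadhan p (conj_power p y) + ?c x"
      unfolding varadhan_def[of p "?f x"]
    proof (rule cSUP_least)
      fix a :: real assume a: "a \<in> {0..<1}"
      have "conj_power p y a + rate p a \<le> varadhan p (conj_power p y)"
        using a p y by (intro le_varadhan conj_power_mono) auto
      then show "?f x a + rate p a \<le> varadhan p (conj_power p y) + ?c x"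
        using quadratic_conjugate_le(1)[OF p, of x y a] x y a by simp
    qed auto
    then show ?thesis using x by (simp add: Ep)
  qed
  show bdd: "bdd_above ((\<lambda>x. Ep p (x * y) - ?c x) ` {0..})"
    by (rule bdd_aboveI2) (rule le)
  show "(SUP x\<in>{0..}. Ep p (x * y) - ?c x) = varadhan p (conj_power p y)"
  proof (rule antisym)
    show "(SUP x\<in>{0..}. Ep p (x * y) - ?c x) \<le> varadhan p (conj_power p y)"
      using le by (intro cSUP_least) auto
    show "varadhan p (conj_power p y) \<le> (SUP x\<in>{0..}. Ep p (x * y) - ?c x)"
      unfolding varadhan_def
    proof (rule cSUP_least)
      fix a :: real assume a: "a \<in> {0..<1}"
      define x where "x = (y * a\<^sup>2) powr ((2 - p) / (2 * p - 2))"
      have x: "x \<ge> 0" by (simp add: x_def)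
      have "conj_power p y a + rate p a = ?f x a - ?c x + rate p a"
        using quadratic_conjugate_le(2)[OF p x y _ x_def] a by simp
      also have "\<dots> \<le> Ep p (x * y) - ?c x"
        using le_varadhan[OF p' mono[OF x], of a] a by (simp add: Ep x)
      also have "\<dots> \<le> (SUP x\<in>{0..}. Ep p (x * y) - ?c x)"
        using x by (intro cSUP_upper bdd) auto
      finally show "conj_power p y a + rate p a \<le> (SUP x\<in>{0..}. Ep p (x * y) - ?c x)" .
    qed auto
  qed
qed

section \<open>The tilted moment and the supremum over z\<close>

text \<open>A nonnegative integral, so that powers can be computed by independence before finiteness
  is known; finiteness follows from \<open>tilt_power_le\<close>.\<close>

definition tilt :: "real \<Rightarrow> real \<Rightarrow> real \<Rightarrow> ennreal" where
  "tilt p s z = (\<integral>\<^sup>+x. ennreal (exp (s * z * x - z powr p * \<bar>x\<bar> powr p / p)) \<partial>rho_measure p)"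

text \<open>The substitution \<open>x \<mapsto> (1 + z\<^sup>p)\<^bsup>-1/p\<^esup> x\<close> absorbs the logarithmic term into the tilt.\<close>

lemma psi_eq_tilt:
  assumes p: "p > 0" and z: "z \<ge> 0" and fin: "tilt p s z = ennreal r" "r > 0"
  shows "psi p (s * z / (1 + z powr p) powr (1/p)) - (1/p) * ln (1 + z powr p) = ln r"
proof -
  define c where "c = (1 + z powr p) powr (- (1/p))"
  have pos: "1 + z powr p > 0" by (simp add: add_pos_nonneg)
  then have c: "c > 0" by (simp add: c_def)
  have cp: "c powr (-p) = 1 + z powr p"
    using p pos by (simp add: c_def powr_powr)
  have "(\<integral>\<^sup>+x. ennreal (exp (s * z * (c * x))) \<partial>rho_measure p) =
      (\<integral>\<^sup>+x. ennreal (exp (s * z * x)) \<partial>distr (rho_measure p) (rho_measure p) (\<lambda>x. c * x))"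
    by (subst nn_integral_distr) auto
  also have "\<dots> = (\<integral>\<^sup>+x. ennreal (exp ((1 - \<bar>c\<bar> powr (-p)) * \<bar>x\<bar> powr p / p) / \<bar>c\<bar>) *
      ennreal (exp (s * z * x)) \<partial>rho_measure p)"
    using p c by (subst distr_scale_rho) (auto intro!: nn_integral_density)
  also have "\<dots> = (\<integral>\<^sup>+x. ennreal (1 / c) * ennreal (exp (s * z * x - z powr p * \<bar>x\<bar> powr p / p)) \<partial>rho_measure p)"
    using c by (intro nn_integral_cong) (simp add: cp exp_diff exp_minus field_simps flip: ennreal_mult)
  also have "\<dots> = ennreal (1 / c) * tilt p s z"
    unfolding tilt_def by (rule nn_integral_cmult) measurable
  also have "\<dots> = ennreal (r / c)"
    using c fin by (simp flip: ennreal_mult)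
  finally have "(\<integral>x. exp (s * z * (c * x)) \<partial>rho_measure p) = r / c"
    using c fin by (subst integral_eq_nn_integral) auto
  moreover have "s * z / (1 + z powr p) powr (1/p) = s * z * c"
    by (simp add: c_def powr_minus divide_inverse)
  ultimately have "psi p (s * z / (1 + z powr p) powr (1/p)) = ln (r / c)"
    by (simp add: psi_def mult_ac)
  also have "\<dots> = ln r - ln c" using c fin by (simp add: ln_div)
  also have "ln c = - (1/p) * ln (1 + z powr p)"
    using pos by (simp add: c_def ln_powr)
  finally show ?thesis by simp
qed

context
  fixes p y z :: real
  assumes p: "p > 1" and y: "y \<ge> 0" and z: "z \<ge> 0"
begin

lemma tilt_power:
  "tilt p (sqrt y) z ^ n =
    (\<integral>\<^sup>+x. ennreal (exp (sqrt y * z * (\<Sum>i<n. x i) - z powr p * (\<Sum>i<n. \<bar>x i\<bar> powr p) / p)) \<partial>rhoN n p)"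
proof -
  interpret product_prob_space "\<lambda>_::nat. rho_measure p"
    using product_prob_space_rho[of p] p by simp
  let ?g = "\<lambda>x. exp (sqrt y * z * x - z powr p * \<bar>x\<bar> powr p / p)"
  have "tilt p (sqrt y) z ^ n = (\<Prod>i<n. \<integral>\<^sup>+x. ennreal (?g x) \<partial>rho_measure p)"
    by (simp add: tilt_def)
  also have "\<dots> = (\<integral>\<^sup>+x. (\<Prod>i<n. ennreal (?g (x i))) \<partial>rhoN n p)"
    by (intro product_nn_integral_prod[symmetric]) auto
  also have "\<dots> = (\<integral>\<^sup>+x. ennreal (exp (sqrt y * z * (\<Sum>i<n. x i) - z powr p * (\<Sum>i<n. \<bar>x i\<bar> powr p) / p)) \<partial>rhoN n p)"
    by (intro nn_integral_cong)
       (simp add: prod_ennreal exp_sum[symmetric] sum_subtractf sum_distrib_left sum_divide_distrib)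
  finally show ?thesis .
qed

text \<open>The integral is restricted to the tail set, where the exponent is smallest when S = n a
  and the p-th powers sum to n.\<close>

lemma tilt_power_ge:
  "ennreal (exp (real n * (sqrt y * z * a - z powr p / p)) * tail p a n) \<le> tilt p (sqrt y) z ^ n"
proof -
  interpret prob_space "rhoN n p" using prob_space_rhoN p by auto
  have "ennreal (exp (real n * (sqrt y * z * a - z powr p / p)) * tail p a n) =
      (\<integral>\<^sup>+x. ennreal (exp (real n * (sqrt y * z * a - z powr p / p))) * indicator (tail_set n p a) x \<partial>rhoN n p)"
    by (simp add: nn_integral_cmult_indicator tail_def emeasure_eq_measure ennreal_mult)
  also have "\<dots> \<le> tilt p (sqrt y) z ^ n"
    unfolding tilt_power
  proof (rule nn_integral_mono)
    fix x
    have "real n * (sqrt y * z * a - z powr p / p) \<le>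
        sqrt y * z * (\<Sum>i<n. x i) - z powr p * (\<Sum>i<n. \<bar>x i\<bar> powr p) / p" if x: "x \<in> tail_set n p a"
    proof -
      have "sqrt y * z * (real n * a) \<le> sqrt y * z * (\<Sum>i<n. x i)"
        using x y z by (intro mult_left_mono) (auto simp: tail_set_def)
      moreover have "z powr p * (\<Sum>i<n. \<bar>x i\<bar> powr p) / p \<le> z powr p * real n / p"
        using x p by (intro divide_right_mono mult_left_mono) (auto simp: tail_set_def)
      ultimately show ?thesis by (simp add: algebra_simps)
    qed
    then show "ennreal (exp (real n * (sqrt y * z * a - z powr p / p))) * indicator (tail_set n p a) x \<le>
        ennreal (exp (sqrt y * z * (\<Sum>i<n. x i) - z powr p * (\<Sum>i<n. \<bar>x i\<bar> powr p) / p))"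
      by (auto simp: indicator_def intro!: ennreal_leI)
  qed
  finally show ?thesis .
qed

text \<open>With S = n R m the exponent is n times Young's expression in z R. Its bound no longer
  contains R or z.\<close>

lemma tilt_power_le:
  assumes n: "n > 0"
  shows "tilt p (sqrt y) z ^ n \<le> ennreal (expmean n p (conj_power p y))"
proof -
  have "tilt p (sqrt y) z ^ n \<le> (\<integral>\<^sup>+x. ennreal (exp (real n * conj_power p y \<bar>mean n p x\<bar>)) \<partial>rhoN n p)"
    unfolding tilt_power
  proof (intro nn_integral_mono_AE eventually_mono[OF AE_normp_pos[OF _ n, of p]] ennreal_leI iffD2[OF exp_le_cancel_iff])
    fix x assume R: "normp n p x > 0"
    let ?R = "normp n p x"
    have "(\<Sum>i<n. x i) = real n * ?R * mean n p x"
      using R n by (simp add: mean_def)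
    moreover have "(\<Sum>i<n. \<bar>x i\<bar> powr p) = real n * ?R powr p"
      using n p by (simp add: sum_powr_eq_normp)
    ultimately have "sqrt y * z * (\<Sum>i<n. x i) - z powr p * (\<Sum>i<n. \<bar>x i\<bar> powr p) / p =
        real n * (sqrt y * mean n p x * (z * ?R) - (z * ?R) powr p / p)"
      using z by (simp add: powr_mult algebra_simps)
    also have "\<dots> \<le> real n * (sqrt y * \<bar>mean n p x\<bar> * (z * ?R) - (z * ?R) powr p / p)"
      using y z by (intro mult_left_mono diff_right_mono mult_right_mono) auto
    also have "\<dots> \<le> real n * conj_power p y \<bar>mean n p x\<bar>"
      unfolding conj_power_def using y z p by (intro mult_left_mono young_conjugate_le) auto
    finally show "sqrt y * z * (\<Sum>i<n. x i) - z powr p * (\<Sum>i<n. \<bar>x i\<bar> powr p) / p \<le>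
        real n * conj_power p y \<bar>mean n p x\<bar>" .
  qed (use p in auto)
  also have "\<dots> = ennreal (expmean n p (conj_power p y))"
    unfolding expmean_def
    by (intro nn_integral_eq_integral integrable_expmean conj_power_mono) (use p y n in auto)
  finally show ?thesis .
qed

text \<open>The moment r does not depend on n, so both bounds on r^n can be divided by n after
  taking logarithms and passed to the limit.\<close>

lemma tilt_bounds:
  obtains r where "r > 0" "tilt p (sqrt y) z = ennreal r" "ln r \<le> varadhan p (conj_power p y)"
    "\<And>a. 0 \<le> a \<Longrightarrow> a < 1 \<Longrightarrow> sqrt y * z * a - z powr p / p + rate p a \<le> ln r"
proof -
  have mono: "mono_on {0..1} (conj_power p y)" by (rule conj_power_mono[OF p y])
  have p': "1 \<le> p" using p by simp
  define r where "r = enn2real (tilt p (sqrt y) z)"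
  have "tilt p (sqrt y) z < \<infinity>"
    using tilt_power_le[of 1] by (simp add: le_less_trans)
  then have r: "tilt p (sqrt y) z = ennreal r" "r \<ge> 0" by (auto simp: r_def)
  have lower: "exp (real n * (sqrt y * z * a - z powr p / p)) * tail p a n \<le> r ^ n" for n a
    using tilt_power_ge[of n a] r by (simp add: ennreal_power)
  \<comment> \<open>Positivity of r comes from the lower bound at level 0 with a single
    coordinate.\<close>
  have "0 < exp (real 1 * (sqrt y * z * 0 - z powr p / p)) * tail p 0 1"
    using tail_pos[of p 0 1] p by (intro mult_pos_pos) auto
  also have "\<dots> \<le> r ^ 1" by (rule lower)
  finally have r0: "r > 0" by simp
  show thesis
  proof (rule that[OF r0 r(1)])
    have ev: "ln r \<le> ln (expmean n p (conj_power p y)) / real n" if n: "n > 0" for n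
    proof -
      have "r ^ n \<le> expmean n p (conj_power p y)"
        using tilt_power_le[OF n] r expmean_pos[OF p' mono conj_power_measurable n]
        by (simp add: ennreal_power)
      then have "ln (r ^ n) \<le> ln (expmean n p (conj_power p y))"
        using r0 by (intro ln_mono) auto
      then show ?thesis using r0 n by (simp add: ln_realpow field_simps)
    qed
    show "ln r \<le> varadhan p (conj_power p y)"
      by (rule LIMSEQ_le_const[OF varadhan_limit[OF p' mono conj_power_measurable conj_power_continuous[OF p y]]])
         (use ev in \<open>auto intro!: exI[of _ 1]\<close>)
    fix a :: real assume a: "0 \<le> a" "a < 1"
    have ev: "sqrt y * z * a - z powr p / p + ln (tail p a n) / real n \<le> ln r" if n: "n > 0" for n
    proof -
      have t: "tail p a n > 0" using tail_pos a p by auto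
      have "ln (exp (real n * (sqrt y * z * a - z powr p / p)) * tail p a n) \<le> ln (r ^ n)"
        using t by (intro ln_mono lower) auto
      then have "real n * (sqrt y * z * a - z powr p / p) + ln (tail p a n) \<le> real n * ln r"
        using t r0 by (simp add: ln_mult ln_realpow)
      then have "(real n * (sqrt y * z * a - z powr p / p) + ln (tail p a n)) / real n \<le> real n * ln r / real n"
        by (intro divide_right_mono) auto
      then show ?thesis using n by (simp add: add_divide_distrib)
    qed
    have "(\<lambda>n. sqrt y * z * a - z powr p / p + ln (tail p a n) / real n) \<longlonglongrightarrow>
        sqrt y * z * a - z powr p / p + rate p a"
      using p a by (intro tendsto_intros tail_limit) auto
    then show "sqrt y * z * a - z powr p / p + rate p a \<le> ln r"
      by (rule LIMSEQ_le_const2) (use ev in \<open>auto intro!: exI[of _ 1]\<close>)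
  qed
qed

end

text \<open>By \<open>psi_eq_tilt\<close> each g z is the logarithm of a tilted moment, so
  \<open>tilt_bounds\<close> gives the upper bound. For the lower one, each level a is matched with
  the z at which Young's inequality is an equality.\<close>

lemma Sup_psi:
  assumes p: "1 < p" and y: "y \<ge> 0"
  defines "g \<equiv> \<lambda>z. psi p (sqrt y * z / (1 + \<bar>z\<bar> powr p) powr (1/p)) - (1/p) * ln (1 + \<bar>z\<bar> powr p)"
  shows "(SUP z\<in>{0..}. g z) = varadhan p (conj_power p y)"
    and "bdd_above (g ` {0..})"
proof -
  have g: "g z \<le> varadhan p (conj_power p y) \<and>
      (\<forall>a. 0 \<le> a \<and> a < 1 \<longrightarrow> sqrt y * z * a - z powr p / p + rate p a \<le> g z)" if z: "z \<ge> 0" for z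
  proof -
    obtain r where "r > 0" "tilt p (sqrt y) z = ennreal r" "ln r \<le> varadhan p (conj_power p y)"
      "\<And>a. 0 \<le> a \<Longrightarrow> a < 1 \<Longrightarrow> sqrt y * z * a - z powr p / p + rate p a \<le> ln r"
      by (rule tilt_bounds[OF p y z]) blast
    moreover from this have "g z = ln r"
      unfolding g_def using psi_eq_tilt[of p z "sqrt y" r] p z by simp
    ultimately show ?thesis by simp
  qed
  show bdd: "bdd_above (g ` {0..})"
    using g by (intro bdd_aboveI2) auto
  show "(SUP z\<in>{0..}. g z) = varadhan p (conj_power p y)"
  proof (rule antisym)
    show "(SUP z\<in>{0..}. g z) \<le> varadhan p (conj_power p y)"
      using g by (intro cSUP_least) auto
    show "varadhan p (conj_power p y) \<le> (SUP z\<in>{0..}. g z)"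
      unfolding varadhan_def
    proof (rule cSUP_least)
      fix a :: real assume a: "a \<in> {0..<1}"
      define z where "z = (sqrt y * a) powr (1 / (p - 1))"
      have z: "z \<ge> 0" by (simp add: z_def)
      have "conj_power p y a = sqrt y * a * z - z powr p / p"
        unfolding conj_power_def z_def using p y a by (intro young_conjugate_eq[symmetric]) auto
      then have "conj_power p y a + rate p a \<le> g z"
        using g[OF z] a by (auto simp: mult_ac)
      also have "\<dots> \<le> (SUP z\<in>{0..}. g z)"
        using z by (intro cSUP_upper bdd) auto
      finally show "conj_power p y a + rate p a \<le> (SUP z\<in>{0..}. g z)" .
    qed auto
  qed
qed

section \<open>Equality of the suprema and the bound for every w\<close>

theorem theorem1p3:
  fixes p :: real
  assumes "1 < p" and "p < 2"
  shows "(\<forall>y::real. y \<ge> 0 \<longrightarrow>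
           Sup ((\<lambda>z. psi p (sqrt y * z / (1 + \<bar>z\<bar> powr p) powr (1/p))
                      - (1/p) * ln (1 + \<bar>z\<bar> powr p)) ` {0..})
         = Sup ((\<lambda>x. Ep p (x * y) - (2 - p) / (2 * p) * x powr (p / (2 - p))) ` {0..}))
      \<and> (\<forall>\<beta>::real. \<beta> \<ge> 0 \<longrightarrow>
           lim (\<lambda>n. ln (Zpart n p \<beta>) / real n)
           \<le> Inf ((\<lambda>w. Sup ((\<lambda>z. psi p (sqrt \<beta> * z * w / (1 + z powr p) powr (1/p))
                                  - (1/p) * ln (1 + \<bar>z\<bar> powr p)
                                  + (2 - p) / (2 * p) * w powr (2 * p / (p - 2))) ` {0..}))
                   ` {0<..}))"
proof (intro conjI allI impI)
  fix y :: real assume "y \<ge> 0"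
  then show "(SUP z\<in>{0..}. psi p (sqrt y * z / (1 + \<bar>z\<bar> powr p) powr (1/p)) - (1/p) * ln (1 + \<bar>z\<bar> powr p))
      = (SUP x\<in>{0..}. Ep p (x * y) - (2 - p) / (2 * p) * x powr (p / (2 - p)))"
    using assms by (simp only: Sup_psi Sup_free_energy)
next
  fix \<beta> :: real assume b: "\<beta> \<ge> 0"
  show "lim (\<lambda>n. ln (Zpart n p \<beta>) / real n) \<le> (INF w\<in>{0<..}. SUP z\<in>{0..}.
      psi p (sqrt \<beta> * z * w / (1 + z powr p) powr (1/p)) - (1/p) * ln (1 + \<bar>z\<bar> powr p)
        + (2 - p) / (2 * p) * w powr (2 * p / (p - 2)))"
  proof (rule cINF_greatest)
    fix w :: real assume "w \<in> {0<..}"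
    then have w: "w > 0" by simp
    define y where "y = \<beta> * w\<^sup>2"
    define x where "x = w powr (-2)"
    have y: "y \<ge> 0" using b by (simp add: y_def)
    have sqrt_y: "sqrt y = sqrt \<beta> * w" using w by (simp add: y_def real_sqrt_mult)
    have xy: "x * y = \<beta>" using w by (simp add: x_def y_def powr_minus)
    define C where "C = (2 - p) / (2 * p) * w powr (2 * p / (p - 2))"
    \<comment> \<open>With this exponent the penalty at x = w^(-2) is exactly the additive term in
      w.\<close>
    have "-2 * (p / (2 - p)) = 2 * p / (p - 2)"
      using assms by (simp add: divide_simps) (simp add: algebra_simps)
    then have C: "(2 - p) / (2 * p) * x powr (p / (2 - p)) = C"
      by (simp add: x_def C_def powr_powr)
    let ?g = "\<lambda>z. psi p (sqrt y * z / (1 + \<bar>z\<bar> powr p) powr (1/p)) - (1/p) * ln (1 + \<bar>z\<bar> powr p)"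
    have "Ep p \<beta> - C \<le> (SUP x\<in>{0..}. Ep p (x * y) - (2 - p) / (2 * p) * x powr (p / (2 - p)))"
      unfolding C[symmetric] xy[symmetric] using assms y
      by (intro cSUP_upper2[OF Sup_free_energy(2), of _ _ x]) (auto simp: x_def)
    also have "\<dots> = (SUP z\<in>{0..}. ?g z)"
      using assms y by (simp only: Sup_psi Sup_free_energy)
    finally have E: "Ep p \<beta> - C \<le> (SUP z\<in>{0..}. ?g z)" .
    let ?h = "\<lambda>z. psi p (sqrt \<beta> * z * w / (1 + z powr p) powr (1/p)) - (1/p) * ln (1 + \<bar>z\<bar> powr p) + C"
    have h: "?h z = ?g z + C" if "z \<ge> 0" for z
      using that by (simp add: sqrt_y mult_ac)
    \<comment> \<open>Moving C out of the supremum needs \<open>?h\<close> bounded above; this is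
      inherited from \<open>?g\<close>.\<close>
    have "(SUP z\<in>{0..}. ?g z) \<le> (SUP z\<in>{0..}. ?h z) - C"
    proof (rule cSUP_least)
      fix z :: real assume z: "z \<in> {0..}"
      have "bdd_above (?h ` {0..})"
      proof -
        obtain M where "\<And>z. z \<ge> 0 \<Longrightarrow> ?g z \<le> M"
          using Sup_psi(2)[OF assms(1) y] by (auto simp: bdd_above_def)
        then show ?thesis using h by (intro bdd_aboveI2[of _ _ "M + C"]) auto
      qed
      then have "?h z \<le> (SUP z\<in>{0..}. ?h z)" by (rule cSUP_upper[OF z])
      then show "?g z \<le> (SUP z\<in>{0..}. ?h z) - C" using h[of z] z by simp
    qed auto
    then have "Ep p \<beta> \<le> (SUP z\<in>{0..}. ?h z)" using E by simp
    then show "lim (\<lambda>n. ln (Zpart n p \<beta>) / real n) \<le> (SUP z\<in>{0..}.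
        psi p (sqrt \<beta> * z * w / (1 + z powr p) powr (1/p)) - (1/p) * ln (1 + \<bar>z\<bar> powr p)
        + (2 - p) / (2 * p) * w powr (2 * p / (p - 2)))"
      unfolding Ep_def C_def .
  qed auto
qed

end
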